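(* Let $(X,T)$ be a saturated topological dynamical system, let $r\ge1$, let $\mathbb{B}$ be a real Banach space, let $\Phi:X^r\to\mathbb{B}^*$ be continuous (with $\mathbb{B}^*$ carrying the weak-star topology $\sigma(\mathbb{B}^*,\mathbb{B})$), let $\alpha\in\mathbb{B}^*$ and $W\subset\mathbb{B}$. Define $$E_\Phi(\alpha,W)=\Big\{x\in X:\ \limsup_{n\to\infty}\langle V_\Phi(n,x),w\rangle\le\langle\alpha,w\rangle\ \text{for all } w\in W\Big\},$$ where $V_\Phi(n,x)=n^{-r}\sum_{1\le i_1,\dots,i_r\le n}\Phi(T^{i_1}x,\dots,T^{i_r}x)$, and $$\mathcal{M}_\Phi(\alpha,W)=\Big\{\mu\in\mathcal{M}_{\rm inv}:\ \int_{X^r}\langle\Phi,w\rangle\,d\mu^{\otimes r}\le\langle\alpha,w\rangle\ \text{for all } w\in W\Big\}.$$ If $\mathcal{M}_\Phi(\alpha,W)=\emptyset$, then $E_\Phi(\alpha,W)=\emptyset$. If $\mathcal{M}_\Phi(\alpha,W)\neq\emptyset$, then $$h_{\rm top}(E_\Phi(\alpha,W))=\sup_{\mu\in\mathcal{M}_\Phi(\alpha,W)}h_\mu.$$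
   Context: $X$ is a compact metric space with metric $d$, $T:X\to X$ is continuous, $X^r$ is the $r$-fold product, $\mu^{\otimes r}$ the $r$-fold product measure. $\langle y,x\rangle$ denotes the duality pairing for $y\in\mathbb{B}^*$, $x\in\mathbb{B}$. $\mathcal{M}_{\rm inv}$ is the set of $T$-invariant Borel probability measures on $X$ and $h_\mu$ the measure-theoretic entropy. Topological entropy of a set (Bowen): with $d_n(x,y)=\max_{0\le j<n}d(T^jx,T^jy)$ and $B_n(x,\epsilon)$ the open $d_n$-ball, for $Z\subset X$ let $H^s_n(Z,\epsilon)=\inf\sum_ie^{-sn_i}$ over countable covers $\{B_{n_i}(x_i,\epsilon)\}$ of $Z$ with $\min_in_i\ge n$, $H^s(Z,\epsilon)=\lim_nH^s_n(Z,\epsilon)$, $h_{\rm top}(Z,\epsilon)$ the critical $s$ where $H^s(Z,\epsilon)$ jumps from $+\infty$ to $0$, and $h_{\rm top}(Z)=\lim_{\epsilon\to0}h_{\rm top}(Z,\epsilon)$. $G_\mu=\{x:\frac1n\sum_{j=0}^{n-1}\delta_{T^jx}\to\mu$ weak-star$\}$; $(X,T)$ is saturated if $h_{\rm top}(G_\mu)=h_\mu$ for all $\mu\in\mathcal{M}_{\rm inv}$. *)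

theory Defs
  imports "HOL-Probability.Probability"
begin

definition dyn_dist :: "('a::metric_space \<Rightarrow> 'a) \<Rightarrow> nat \<Rightarrow> 'a \<Rightarrow> 'a \<Rightarrow> real" where
  "dyn_dist T n x y = Max (insert 0 ((\<lambda>j. dist ((T^^j) x) ((T^^j) y)) ` {..<n}))"

definition bowen_ball :: "('a::metric_space \<Rightarrow> 'a) \<Rightarrow> 'a set \<Rightarrow> nat \<Rightarrow> 'a \<Rightarrow> real \<Rightarrow> 'a set" where
  "bowen_ball T X n x eps = {y \<in> X. dyn_dist T n x y < eps}"

definition bowen_Hn :: "('a::metric_space \<Rightarrow> 'a) \<Rightarrow> 'a set \<Rightarrow> 'a set \<Rightarrow> real \<Rightarrow> real \<Rightarrow> nat \<Rightarrow> ennreal" where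
  "bowen_Hn T X Z s eps n =
     (INF C \<in> {C. countable C \<and> C \<subseteq> X \<times> {n..} \<and> Z \<subseteq> (\<Union>p\<in>C. bowen_ball T X (snd p) (fst p) eps)}.
        (\<integral>\<^sup>+ p. ennreal (exp (- s * real (snd p))) \<partial>count_space C))"

definition bowen_H :: "('a::metric_space \<Rightarrow> 'a) \<Rightarrow> 'a set \<Rightarrow> 'a set \<Rightarrow> real \<Rightarrow> real \<Rightarrow> ennreal" where
  "bowen_H T X Z s eps = lim (bowen_Hn T X Z s eps)"

definition htop_eps :: "('a::metric_space \<Rightarrow> 'a) \<Rightarrow> 'a set \<Rightarrow> 'a set \<Rightarrow> real \<Rightarrow> ereal" where
  "htop_eps T X Z eps = Inf {ereal s | s. bowen_H T X Z s eps = 0}"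

definition htop :: "('a::metric_space \<Rightarrow> 'a) \<Rightarrow> 'a set \<Rightarrow> 'a set \<Rightarrow> ereal" where
  "htop T X Z = Lim (at_right 0) (htop_eps T X Z)"

definition Minv :: "'a::metric_space set \<Rightarrow> ('a \<Rightarrow> 'a) \<Rightarrow> 'a measure set" where
  "Minv X T = {M. prob_space M \<and> sets M = sets (restrict_space borel X) \<and> T \<in> measurable M M \<and> distr M M T = M}"

definition finite_meas_partition :: "'a measure \<Rightarrow> 'a set set \<Rightarrow> bool" where
  "finite_meas_partition M P \<longleftrightarrow> finite P \<and> P \<subseteq> sets M \<and> disjoint P \<and> \<Union>P = space M"

definition part_entropy :: "'a measure \<Rightarrow> 'a set set \<Rightarrow> real" where
  "part_entropy M P = - (\<Sum>A\<in>P. measure M A * ln (measure M A))"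

definition iter_join :: "'a measure \<Rightarrow> ('a \<Rightarrow> 'a) \<Rightarrow> 'a set set \<Rightarrow> nat \<Rightarrow> 'a set set" where
  "iter_join M T P n = {(\<Inter>i<n. (T^^i) -` f i) \<inter> space M | f. f \<in> {..<n} \<rightarrow>\<^sub>E P}"

definition ks_entropy_part :: "'a measure \<Rightarrow> ('a \<Rightarrow> 'a) \<Rightarrow> 'a set set \<Rightarrow> real" where
  "ks_entropy_part M T P = lim (\<lambda>n. part_entropy M (iter_join M T P n) / real n)"

definition ks_entropy :: "'a measure \<Rightarrow> ('a \<Rightarrow> 'a) \<Rightarrow> ereal" where
  "ks_entropy M T = (SUP P \<in> {P. finite_meas_partition M P}. ereal (ks_entropy_part M T P))"

definition generic_points :: "'a::metric_space set \<Rightarrow> ('a \<Rightarrow> 'a) \<Rightarrow> 'a measure \<Rightarrow> 'a set" where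
  "generic_points X T \<mu> = {x \<in> X. \<forall>f::'a \<Rightarrow> real. continuous_on X f \<longrightarrow>
      (\<lambda>n. (\<Sum>j<n. f ((T^^j) x)) / real n) \<longlonglongrightarrow> integral\<^sup>L \<mu> f}"

definition saturated :: "'a::metric_space set \<Rightarrow> ('a \<Rightarrow> 'a) \<Rightarrow> bool" where
  "saturated X T \<longleftrightarrow> (\<forall>\<mu>\<in>Minv X T. htop T X (generic_points X T \<mu>) = ks_entropy \<mu> T)"

text \<open>Points of X^r are functions on {..<r}; the dual B* is 'b =>L real.\<close>
definition V_Phi :: "('a \<Rightarrow> 'a) \<Rightarrow> ((nat \<Rightarrow> 'a) \<Rightarrow> ('b::real_normed_vector \<Rightarrow>\<^sub>L real)) \<Rightarrow> nat \<Rightarrow> nat \<Rightarrow> 'a \<Rightarrow> ('b \<Rightarrow>\<^sub>L real)" where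
  "V_Phi T \<Phi> r n x = (1 / real n ^ r) *\<^sub>R
      (\<Sum>i\<in>{..<r} \<rightarrow>\<^sub>E {1..n}. \<Phi> (\<lambda>j\<in>{..<r}. (T^^(i j)) x))"

definition E_Phi :: "'a set \<Rightarrow> ('a \<Rightarrow> 'a) \<Rightarrow> ((nat \<Rightarrow> 'a) \<Rightarrow> ('b::real_normed_vector \<Rightarrow>\<^sub>L real)) \<Rightarrow> nat
      \<Rightarrow> ('b \<Rightarrow>\<^sub>L real) \<Rightarrow> 'b set \<Rightarrow> 'a set" where
  "E_Phi X T \<Phi> r \<alpha> W = {x \<in> X. \<forall>w\<in>W.
      limsup (\<lambda>n. ereal (blinfun_apply (V_Phi T \<Phi> r n x) w)) \<le> ereal (blinfun_apply \<alpha> w)}"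

definition M_Phi :: "'a::metric_space set \<Rightarrow> ('a \<Rightarrow> 'a) \<Rightarrow> ((nat \<Rightarrow> 'a) \<Rightarrow> ('b::real_normed_vector \<Rightarrow>\<^sub>L real)) \<Rightarrow> nat
      \<Rightarrow> ('b \<Rightarrow>\<^sub>L real) \<Rightarrow> 'b set \<Rightarrow> 'a measure set" where
  "M_Phi X T \<Phi> r \<alpha> W = {\<mu> \<in> Minv X T. \<forall>w\<in>W.
      (\<integral>z. blinfun_apply (\<Phi> z) w \<partial>(PiM {..<r} (\<lambda>_. \<mu>))) \<le> blinfun_apply \<alpha> w}"

end

theory Submission
  imports Defs
begin

text \<open>
  The points generic for \<open>\<mu> \<in> M_Phi\<close> lie in \<open>E_Phi\<close>, so saturation gives the lower bound. Conversely, along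
  a subsequence the empirical measures of a point of \<open>E_Phi\<close> converge to an invariant measure, whose
  powers are the limits of the powers of the empirical measures, so that it lies in \<open>M_Phi\<close>. The
  upper bound is then Bowen's theorem: the points having a limit measure of entropy at most \<open>t\<close> form a
  set of topological entropy at most \<open>t\<close>. If \<open>t < \<kappa>\<close>, the block entropy of length \<open>m\<close> of the limit
  measure is below \<open>m \<kappa>\<close> for some \<open>m\<close>; coding blocks with lengths adapted to that measure, the
  itinerary of the point up to time \<open>n\<close> has code length below \<open>n \<kappa>\<close> for infinitely many \<open>n\<close>, and at most
  \<open>exp (n \<kappa>)\<close> itineraries have this property. Rounding the weights to rationals leaves countably
  many codes.
\<close>

section \<open>Bowen entropy\<close>

text \<open>The obstacle is that the limit measure varies with the point, so uncountably many
  measures and partitions occur, while topological entropy is only stable under countable unions. At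
  each scale \<open>eps\<close> a fixed finite cover supplies the alphabet, and a measure enters the
  covering argument only through a block length \<open>m\<close> and a weight function on words.
  Weak-star convergence bounds the frequencies of closed sets from above only. This suffices because
  code lengths are nonnegative: overestimating how often each word occurs overestimates the cost.
  That closing up the cylinders adds no mass is arranged by the radius of the balls, which avoids
  the countably many radii whose spheres carry mass. Averaging over all ways of cutting is forced by
  the data: the limit measure sees the average of a window function over all starting times, not
  over one arithmetic progression of them.\<close>

lemma bowen_Hn_le:
  assumes "countable C" "C \<subseteq> X \<times> {n..}" "Z \<subseteq> (\<Union>p\<in>C. bowen_ball T X (snd p) (fst p) eps)"
  shows "bowen_Hn T X Z s eps n \<le> (\<integral>\<^sup>+ p. ennreal (exp (- s * real (snd p))) \<partial>count_space C)"
  unfolding bowen_Hn_def using assms by (intro INF_lower) auto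

lemma bowen_Hn_mono:
  assumes "Z \<subseteq> Z'" "n \<le> n'" "eps' \<le> eps"
  shows "bowen_Hn T X Z s eps n \<le> bowen_Hn T X Z' s eps' n'"
  unfolding bowen_Hn_def
proof (rule INF_superset_mono, rule subsetI)
  fix C assume "C \<in> {C. countable C \<and> C \<subseteq> X \<times> {n'..} \<and> Z' \<subseteq> (\<Union>p\<in>C. bowen_ball T X (snd p) (fst p) eps')}"
  then have C: "countable C" "C \<subseteq> X \<times> {n'..}" "Z' \<subseteq> (\<Union>p\<in>C. bowen_ball T X (snd p) (fst p) eps')"
    by auto
  have "bowen_ball T X k x eps' \<subseteq> bowen_ball T X k x eps" for k x
    using assms(3) by (auto simp: bowen_ball_def)
  then have "Z \<subseteq> (\<Union>p\<in>C. bowen_ball T X (snd p) (fst p) eps)"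
    using C(3) assms(1) by (meson UN_mono order_refl order_trans)
  moreover have "C \<subseteq> X \<times> {n..}" using C(2) assms(2) by auto
  ultimately show "C \<in> {C. countable C \<and> C \<subseteq> X \<times> {n..} \<and> Z \<subseteq> (\<Union>p\<in>C. bowen_ball T X (snd p) (fst p) eps)}"
    using C(1) by blast
qed simp

text \<open>Near-optimal covers of the \<open>Z k\<close>, with errors
  \<open>e * (1/2) ^ Suc k\<close> adding up to \<open>e\<close>, are united; a ball shared by
  several covers is counted once on the left and repeatedly on the right.\<close>

lemma bowen_Hn_UN_le:
  "bowen_Hn T X (\<Union>k. Z k) s eps n \<le> (\<Sum>k. bowen_Hn T X (Z k) s eps n)"
proof (rule ennreal_le_epsilon)
  fix e :: real assume e: "e > 0" and fin: "(\<Sum>k. bowen_Hn T X (Z k) s eps n) < \<top>"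
  let ?I = "\<lambda>C. (\<integral>\<^sup>+ p. ennreal (exp (- s * real (snd p))) \<partial>count_space C)"
  have "\<exists>C. countable C \<and> C \<subseteq> X \<times> {n..} \<and> Z k \<subseteq> (\<Union>p\<in>C. bowen_ball T X (snd p) (fst p) eps)
          \<and> ?I C < bowen_Hn T X (Z k) s eps n + ennreal (e * (1/2) ^ Suc k)" for k
  proof -
    \<comment> \<open>Finiteness makes adding a positive number strict in \<open>ennreal\<close>,
      and strictness is what extracts an actual cover from the infimum.\<close>
    have "bowen_Hn T X (Z k) s eps n < \<top>"
      using ennreal_suminf_lessD[OF fin] by simp
    then have "bowen_Hn T X (Z k) s eps n < bowen_Hn T X (Z k) s eps n + ennreal (e * (1/2) ^ Suc k)"
      using e by (simp add: less_top ennreal_zero_less_mult_iff)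
    then show ?thesis
      unfolding bowen_Hn_def INF_less_iff by auto
  qed
  then have "\<exists>C. \<forall>k. countable (C k) \<and> C k \<subseteq> X \<times> {n..} \<and> Z k \<subseteq> (\<Union>p\<in>C k. bowen_ball T X (snd p) (fst p) eps)
          \<and> ?I (C k) < bowen_Hn T X (Z k) s eps n + ennreal (e * (1/2) ^ Suc k)"
    by (intro choice allI)
  then obtain C where CC: "\<forall>k. countable (C k) \<and> C k \<subseteq> X \<times> {n..} \<and> Z k \<subseteq> (\<Union>p\<in>C k. bowen_ball T X (snd p) (fst p) eps)
          \<and> ?I (C k) < bowen_Hn T X (Z k) s eps n + ennreal (e * (1/2) ^ Suc k)"
    by (elim exE)
  note C = CC[rule_format, THEN conjunct1] CC[rule_format, THEN conjunct2, THEN conjunct1]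
    CC[rule_format, THEN conjunct2, THEN conjunct2, THEN conjunct1]
    CC[rule_format, THEN conjunct2, THEN conjunct2, THEN conjunct2]
  have "bowen_Hn T X (\<Union>k. Z k) s eps n \<le> ?I (\<Union>k. C k)"
  proof (rule bowen_Hn_le)
    show "countable (\<Union>k. C k)" using C(1) by simp
    show "(\<Union>k. C k) \<subseteq> X \<times> {n..}" using C(2) by (rule UN_least)
    show "(\<Union>k. Z k) \<subseteq> (\<Union>p\<in>\<Union>k. C k. bowen_ball T X (snd p) (fst p) eps)"
    proof
      fix z assume "z \<in> (\<Union>k. Z k)"
      then obtain k where "z \<in> Z k" by blast
      then have "z \<in> (\<Union>p\<in>C k. bowen_ball T X (snd p) (fst p) eps)" using C(3) by (rule rev_subsetD)
      then show "z \<in> (\<Union>p\<in>\<Union>k. C k. bowen_ball T X (snd p) (fst p) eps)" by blast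
    qed
  qed
  also have "\<dots> \<le> (\<Sum>k. ?I (C k))"
  proof -
    have "?I (\<Union>k. C k) = (\<integral>\<^sup>+ p. ennreal (exp (- s * real (snd p))) * indicator (\<Union>k. C k) p \<partial>count_space UNIV)"
      by (simp add: nn_integral_count_space_indicator)
    also have "\<dots> \<le> (\<integral>\<^sup>+ p. (\<Sum>k. ennreal (exp (- s * real (snd p))) * indicator (C k) p) \<partial>count_space UNIV)"
    proof (intro nn_integral_mono)
      fix p :: "'a \<times> nat"
      let ?w = "ennreal (exp (- s * real (snd p)))"
      show "?w * indicator (\<Union>k. C k) p \<le> (\<Sum>k. ?w * indicator (C k) p)"
      proof (cases "p \<in> (\<Union>k. C k)")
        case True
        then obtain k where k: "p \<in> C k" by auto
        have "?w = sum (\<lambda>k. ?w * indicator (C k) p) {k}" using k by simp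
        also have "\<dots> \<le> (\<Sum>k. ?w * indicator (C k) p)"
          by (intro sum_le_suminf) auto
        finally show ?thesis using True by simp
      qed simp
    qed
    also have "\<dots> = (\<Sum>k. ?I (C k))"
      by (subst nn_integral_suminf) (simp_all add: nn_integral_count_space_indicator)
    finally show ?thesis .
  qed
  also have "\<dots> \<le> (\<Sum>k. bowen_Hn T X (Z k) s eps n + ennreal (e * (1/2) ^ Suc k))"
    using C(4) by (intro suminf_le) (auto intro: less_imp_le)
  also have "\<dots> = (\<Sum>k. bowen_Hn T X (Z k) s eps n) + (\<Sum>k. ennreal (e * (1/2) ^ Suc k))"
    by (intro suminf_add[symmetric]) auto
  also have "(\<Sum>k. ennreal (e * (1/2) ^ Suc k)) = ennreal e"
    using sums_mult[OF power_half_series, of e] e by (intro suminf_ennreal_eq) auto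
  finally show "bowen_Hn T X (\<Union>k. Z k) s eps n \<le> (\<Sum>k. bowen_Hn T X (Z k) s eps n) + ennreal e" .
qed

text \<open>\<open>bowen_H\<close> is a \<open>lim\<close>, which is informative only for a
  convergent sequence. Raising \<open>n\<close> leaves fewer admissible covers, so the infima
  increase.\<close>

lemma bowen_H_eq_SUP: "bowen_H T X Z s eps = (SUP n. bowen_Hn T X Z s eps n)"
  unfolding bowen_H_def
  by (intro limI LIMSEQ_SUP incseq_SucI bowen_Hn_mono) auto

lemma bowen_H_eq_0_iff: "bowen_H T X Z s eps = 0 \<longleftrightarrow> (\<forall>n. bowen_Hn T X Z s eps n = 0)"
  unfolding bowen_H_eq_SUP
  using SUP_eq_iff[of UNIV "0::ennreal" "bowen_Hn T X Z s eps"] by simp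

lemma bowen_H_mono:
  assumes "Z \<subseteq> Z'" "eps' \<le> eps"
  shows "bowen_H T X Z s eps \<le> bowen_H T X Z' s eps'"
  unfolding bowen_H_eq_SUP using assms by (intro SUP_mono' bowen_Hn_mono) auto

text \<open>Countable stability at a single scale and exponent, the form in which the sets belonging
  to countably many codes are put together.\<close>

lemma bowen_H_UN_eq_0:
  assumes "countable I" "\<And>i. i \<in> I \<Longrightarrow> bowen_H T X (Z i) s eps = 0"
  shows "bowen_H T X (\<Union>i\<in>I. Z i) s eps = 0"
proof (cases "I = {}")
  case True
  have "bowen_Hn T X {} s eps n \<le> 0" for n
    using bowen_Hn_le[of "{}" X n "{}" T eps s] by (simp add: nn_integral_empty)
  then have "bowen_Hn T X {} s eps n = 0" for n by (metis le_zero_eq)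
  then show ?thesis using True by (simp add: bowen_H_eq_0_iff)
next
  case False
  have *: "bowen_Hn T X (Z i) s eps n = 0" if "i \<in> I" for i n
    using assms(2)[OF that] by (simp add: bowen_H_eq_0_iff)
  have "(\<Union>i\<in>I. Z i) = (\<Union>k. Z (from_nat_into I k))"
    using range_from_nat_into[OF False assms(1)] by (metis image_image)
  moreover have "bowen_Hn T X (\<Union>k. Z (from_nat_into I k)) s eps n \<le> 0" for n
    using bowen_Hn_UN_le[of T X "\<lambda>k. Z (from_nat_into I k)" s eps n]
    by (simp add: * from_nat_into[OF False])
  ultimately show ?thesis by (simp add: bowen_H_eq_0_iff)
qed

lemma htop_eps_mono:
  assumes "Z \<subseteq> Z'" "eps' \<le> eps"
  shows "htop_eps T X Z eps \<le> htop_eps T X Z' eps'"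
  unfolding htop_eps_def
proof (rule Inf_superset_mono, safe)
  fix s assume "bowen_H T X Z' s eps' = 0"
  then have "bowen_H T X Z s eps = 0"
    using bowen_H_mono[OF assms, of T X s] by simp
  then show "\<exists>s'. ereal s = ereal s' \<and> bowen_H T X Z s' eps = 0" by auto
qed

text \<open>Smaller balls cover less, so \<open>htop_eps\<close> grows as the radius shrinks; the
  one-sided limit therefore exists and is the supremum.\<close>

lemma htop_eq_SUP: "htop T X Z = (SUP e\<in>{0<..}. htop_eps T X Z e)"
  unfolding htop_def
proof (rule tendsto_Lim)
  show "(htop_eps T X Z \<longlongrightarrow> (SUP e\<in>{0<..}. htop_eps T X Z e)) (at_right 0)"
  proof (rule order_tendstoI)
    fix a assume "a < (SUP e\<in>{0<..}. htop_eps T X Z e)"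
    then obtain e where e: "e > 0" "a < htop_eps T X Z e" by (auto simp: less_SUP_iff)
    have "a < htop_eps T X Z d" if "d < e" for d
      using e(2) htop_eps_mono[of Z Z d e T X] that by (auto intro: less_le_trans)
    then show "\<forall>\<^sub>F e in at_right 0. a < htop_eps T X Z e"
      using e(1) by (auto simp: eventually_at_right_field)
  next
    fix a assume a: "(SUP e\<in>{0<..}. htop_eps T X Z e) < a"
    have "htop_eps T X Z e < a" if "e > 0" for e
      using a that by (meson SUP_upper greaterThan_iff le_less_trans)
    then show "\<forall>\<^sub>F e in at_right 0. htop_eps T X Z e < a"
      by (auto simp: eventually_at_right_field intro!: exI[of _ 1])
  qed
qed simp

lemma htop_mono: "Z \<subseteq> Z' \<Longrightarrow> htop T X Z \<le> htop T X Z'"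
  unfolding htop_eq_SUP by (intro SUP_mono' htop_eps_mono) auto

lemma htop_le:
  assumes "\<And>eps s. eps > 0 \<Longrightarrow> t < ereal s \<Longrightarrow> bowen_H T X Z s eps = 0"
  shows "htop T X Z \<le> t"
  unfolding htop_eq_SUP
proof (rule SUP_least)
  fix e :: real assume "e \<in> {0<..}"
  then have "htop_eps T X Z e \<le> ereal s" if "t < ereal s" for s
    using assms that unfolding htop_eps_def by (intro Inf_lower) auto
  then show "htop_eps T X Z e \<le> t"
    using ereal_dense2[of t "htop_eps T X Z e"] by (meson leD leI)
qed

section \<open>Covering orbits with cheap itineraries\<close>

definition words :: "nat \<Rightarrow> nat \<Rightarrow> nat list set" where
  "words N m = {w. set w \<subseteq> {..<N} \<and> length w = m}"

lemma finite_words [simp]: "finite (words N m)"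
  unfolding words_def by (rule finite_lists_length_eq) simp

lemma card_words: "card (words N m) = N ^ m"
  unfolding words_def using card_lists_length_eq[of "{..<N}" m] by simp

lemma map_upt_in_words: "(\<And>i. i < k \<Longrightarrow> u i < N) \<Longrightarrow> map u [0..<k] \<in> words N k"
  by (auto simp: words_def)

lemma sum_words_add:
  "(\<Sum>u\<in>words N (a + b). f u) = (\<Sum>v\<in>words N a. \<Sum>w\<in>words N b. f (v @ w))"
proof -
  have "words N (a + b) = (\<lambda>(v, w). v @ w) ` (words N a \<times> words N b)"
  proof (intro equalityI subsetI)
    fix u assume u: "u \<in> words N (a + b)"
    then have "take a u \<in> words N a" "drop a u \<in> words N b"
      by (auto simp: words_def dest: in_set_takeD in_set_dropD)
    then show "u \<in> (\<lambda>(v, w). v @ w) ` (words N a \<times> words N b)"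
      by (intro image_eqI[of _ _ "(take a u, drop a u)"]) auto
  qed (auto simp: words_def)
  moreover have "inj_on (\<lambda>(v, w). v @ w) (words N a \<times> words N b)"
    by (auto simp: inj_on_def words_def)
  ultimately show ?thesis
    by (simp add: sum.reindex sum.cartesian_product case_prod_unfold)
qed

text \<open>A Kraft inequality with a free prefix: the block weights multiply to total mass at most
  1, and the \<open>p\<close> letters before the first block, which carry no weight, contribute the
  factor \<open>N ^ p\<close>.\<close>

lemma sum_words_prod_le:
  fixes Q :: "nat list \<Rightarrow> real"
  assumes Q: "\<And>w. w \<in> words N m \<Longrightarrow> 0 \<le> Q w" "(\<Sum>w\<in>words N m. Q w) \<le> 1"
  shows "(\<Sum>u\<in>words N (p + m * L). \<Prod>l<L. Q (take m (drop (p + m * l) u))) \<le> real N ^ p"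
proof (induction L)
  case 0
  then show ?case by (simp add: card_words)
next
  case (Suc L)
  let ?W = "\<lambda>L u. \<Prod>l<L. Q (take m (drop (p + m * l) u))"
  have block: "take m (drop (p + m * l) u) \<in> words N m"
    if "u \<in> words N (p + m * L)" "l < L" for u l
  proof -
    have "m * Suc l \<le> m * L" using that by (intro mult_le_mono2) simp
    then show ?thesis
      using that by (auto simp: words_def dest!: in_set_takeD in_set_dropD)
  qed
  have "(\<Sum>u\<in>words N (p + m * Suc L). ?W (Suc L) u) = (\<Sum>u\<in>words N ((p + m * L) + m). ?W (Suc L) u)"
    by (simp add: algebra_simps)
  also have "\<dots> = (\<Sum>v\<in>words N (p + m * L). \<Sum>w\<in>words N m. ?W L v * Q w)"
  proof (subst sum_words_add, intro sum.cong refl)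
    fix v w assume v: "v \<in> words N (p + m * L)" and w: "w \<in> words N m"
    have tk: "take m (drop (p + m * l) (v @ w)) = take m (drop (p + m * l) v)" if "l < L" for l
    proof -
      have "m * Suc l \<le> m * L" using that by (intro mult_le_mono2) simp
      then show ?thesis using v by (simp add: words_def)
    qed
    have "?W L (v @ w) = ?W L v"
      by (rule prod.cong[OF refl]) (simp only: lessThan_iff tk)
    then show "?W (Suc L) (v @ w) = ?W L v * Q w"
      using v w by (simp add: words_def)
  qed
  also have "\<dots> = (\<Sum>v\<in>words N (p + m * L). ?W L v) * (\<Sum>w\<in>words N m. Q w)"
    by (simp add: sum_product)
  also have "\<dots> \<le> (\<Sum>v\<in>words N (p + m * L). ?W L v) * 1"
    using Q(2) by (intro mult_left_mono sum_nonneg prod_nonneg ballI Q(1) block) auto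
  finally show ?case using Suc.IH by simp
qed

text \<open>Pigeonhole over the residues modulo \<open>m\<close>: the progressions
  \<open>p + m * l\<close> with \<open>p < m\<close> and \<open>l < n div m\<close> are disjoint and
  stay below \<open>n\<close>, so their \<open>m\<close> sums average to less than
  \<open>c\<close>.\<close>

lemma ex_residue_sum_less:
  fixes G :: "nat \<Rightarrow> real"
  assumes m: "m \<ge> 1" and G: "\<And>j. G j \<ge> 0" and less: "(\<Sum>j<n. G j) < real m * c"
  shows "\<exists>p<m. (\<Sum>l<n div m. G (p + m * l)) < c"
proof (rule ccontr)
  let ?L = "n div m"
  assume "\<not> ?thesis"
  then have "c \<le> (\<Sum>l<?L. G (p + m * l))" if "p < m" for p
    using that by (meson not_le)
  then have "(\<Sum>p<m. c) \<le> (\<Sum>p<m. \<Sum>l<?L. G (p + m * l))"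
    by (intro sum_mono) simp
  also have "\<dots> = (\<Sum>l<?L. \<Sum>p<m. G (p + m * l))"
    by (rule sum.swap)
  also have "\<dots> = (\<Sum>l<?L. sum G {l * m..<l * m + m})"
  proof (rule sum.cong[OF refl])
    fix l show "(\<Sum>p<m. G (p + m * l)) = sum G {l * m..<l * m + m}"
      by (rule sum.reindex_bij_witness[of _ "\<lambda>j. j - l * m" "\<lambda>p. p + m * l"]) auto
  qed
  also have "\<dots> = sum G {..<?L * m}"
    by (rule sum.nat_group)
  also have "\<dots> \<le> (\<Sum>j<n. G j)"
    using G by (intro sum_mono2) (auto intro: less_le_trans)
  finally show False using less by simp
qed

text \<open>With code lengths \<open>- ln Q\<close> for the words of length \<open>m\<close>, the orbit of \<open>x\<close> admits up to time \<open>n\<close> an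
  itinerary whose code length, averaged over the \<open>m\<close> ways of cutting it into blocks, is below \<open>n \<kappa>\<close>.
  The itinerary may be any labelling by balls containing the orbit points; this freedom later
  allows a partition with null boundary, depending on the limit measure, for a fixed finite cover.\<close>

definition low_cost_points ::
    "('a::metric_space \<Rightarrow> 'a) \<Rightarrow> 'a set \<Rightarrow> (nat \<Rightarrow> 'a) \<Rightarrow> nat \<Rightarrow> real \<Rightarrow> nat \<Rightarrow> (nat list \<Rightarrow> real) \<Rightarrow> real \<Rightarrow> nat \<Rightarrow> 'a set" where
  "low_cost_points T X c N eps m Q \<kappa> n = {x \<in> X. \<exists>u. (\<forall>i. u i < N \<and> dist (c (u i)) ((T^^i) x) < eps / 2)
     \<and> (\<Sum>j<n. - ln (Q (map (\<lambda>i. u (j + i)) [0..<m]))) < real m * (real n * \<kappa>)}"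

text \<open>One of the \<open>m\<close> ways of cutting is at most as costly as the average, and by the Kraft inequality
  at most \<open>exp (n \<kappa>)\<close> sequences of blocks are that cheap.\<close>

lemma bowen_Hn_low_cost_le:
  fixes Q :: "nat list \<Rightarrow> real"
  assumes N: "N \<ge> 1" and m: "m \<ge> 1" and k: "k \<le> m * (n div m)"
    and Q: "\<And>w. w \<in> words N m \<Longrightarrow> 0 < Q w" "(\<Sum>w\<in>words N m. Q w) \<le> 1"
  shows "bowen_Hn T X (low_cost_points T X c N eps m Q \<kappa> n) s eps k
    \<le> ennreal (real m * real N ^ m * exp (\<bar>s\<bar> * real m) * exp (- (s - \<kappa>) * real n))"
proof -
  \<comment> \<open>Words of length \<open>p + m * L\<close> consist of a free prefix and
    \<open>L\<close> full blocks. All balls get the length \<open>m * L\<close>, which is at most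
    the length of every such word.\<close>
  define L where "L = n div m"
  define Wt where "Wt p v = (\<Prod>l<L. Q (take m (drop (p + m * l) v)))" for p v
  define A where "A p = {v \<in> words N (p + m * L). exp (- real n * \<kappa>) < Wt p v}" for p
  define cyl where "cyl v = {y \<in> X. \<forall>i<length v. dist (c (v ! i)) ((T^^i) y) < eps / 2}" for v
  \<comment> \<open>Any point of the cylinder can be the centre of the Bowen ball: two orbits
    following the same word stay within \<open>eps / 2\<close> of the same points \<open>c\<close>,
    hence within \<open>eps\<close> of each other.\<close>
  define z where "z v = (SOME y. y \<in> cyl v)" for v
  define B where "B = {v \<in> (\<Union>p<m. A p). cyl v \<noteq> {}}"
  define C where "C = (\<lambda>v. (z v, m * L)) ` B"
  have Qle: "Q w \<le> 1" if "w \<in> words N m" for w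
    using member_le_sum[of w "words N m" Q] that Q by (force intro: less_imp_le)
  have Wt0: "0 \<le> Wt p v" if "v \<in> words N (p + m * L)" for p v
    unfolding Wt_def
  proof (intro prod_nonneg ballI)
    fix l assume "l \<in> {..<L}"
    then have "m * Suc l \<le> m * L" by (intro mult_le_mono2) simp
    then have "take m (drop (p + m * l) v) \<in> words N m"
      using that by (auto simp: words_def dest!: in_set_takeD in_set_dropD)
    then show "0 \<le> Q (take m (drop (p + m * l) v))" using Q(1) by (auto intro: less_imp_le)
  qed
  \<comment> \<open>Markov's inequality: each word of \<open>A p\<close> weighs more than
    \<open>exp (- real n * \<kappa>)\<close>, and all weights together are at most
    \<open>N ^ p\<close>.\<close>
  have cardA: "real (card (A p)) \<le> real N ^ m * exp (real n * \<kappa>)" if "p < m" for p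
  proof -
    have "real (card (A p)) * exp (- real n * \<kappa>) = (\<Sum>v\<in>A p. exp (- real n * \<kappa>))" by simp
    also have "\<dots> \<le> (\<Sum>v\<in>A p. Wt p v)" by (intro sum_mono) (auto simp: A_def)
    also have "\<dots> \<le> (\<Sum>v\<in>words N (p + m * L). Wt p v)"
      by (intro sum_mono2) (auto simp: A_def Wt0)
    also have "\<dots> \<le> real N ^ p"
      unfolding Wt_def using Q by (intro sum_words_prod_le) (auto intro: less_imp_le)
    also have "\<dots> \<le> real N ^ m" using N that by (intro power_increasing) auto
    finally show ?thesis by (simp add: exp_minus field_simps)
  qed
  have finA: "finite (A p)" for p by (simp add: A_def)
  have finB: "finite B" by (simp add: B_def finA)
  have "real (card B) \<le> real (card (\<Union>p<m. A p))"
    by (intro of_nat_mono card_mono) (auto simp: B_def finA)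
  also have "\<dots> \<le> real (\<Sum>p<m. card (A p))"
    by (intro of_nat_mono card_UN_le) simp
  also have "\<dots> \<le> (\<Sum>p<m. real N ^ m * exp (real n * \<kappa>))"
    unfolding of_nat_sum using cardA by (intro sum_mono) auto
  finally have cardB: "real (card B) \<le> real m * (real N ^ m * exp (real n * \<kappa>))" by simp
  have zcyl: "z v \<in> cyl v" if "v \<in> B" for v
    using that some_in_eq[of "cyl v"] by (auto simp: z_def B_def)
  have "bowen_Hn T X (low_cost_points T X c N eps m Q \<kappa> n) s eps k
      \<le> (\<integral>\<^sup>+ p. ennreal (exp (- s * real (snd p))) \<partial>count_space C)"
  proof (rule bowen_Hn_le)
    show "countable C" using finB by (simp add: C_def countable_finite)
    show "C \<subseteq> X \<times> {k..}" using zcyl k by (auto simp: C_def cyl_def L_def)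
    show "low_cost_points T X c N eps m Q \<kappa> n \<subseteq> (\<Union>p\<in>C. bowen_ball T X (snd p) (fst p) eps)"
    proof
      fix x assume x: "x \<in> low_cost_points T X c N eps m Q \<kappa> n"
      then obtain u where xX: "x \<in> X" and u: "\<And>i. u i < N" "\<And>i. dist (c (u i)) ((T^^i) x) < eps / 2"
        and cost: "(\<Sum>j<n. - ln (Q (map (\<lambda>i. u (j + i)) [0..<m]))) < real m * (real n * \<kappa>)"
        unfolding low_cost_points_def by blast
      have blk: "map (\<lambda>i. u (j + i)) [0..<m] \<in> words N m" for j
        using u by (intro map_upt_in_words) simp
      have "- ln (Q (map (\<lambda>i. u (j + i)) [0..<m])) \<ge> 0" for j
        using Q(1)[OF blk] Qle[OF blk] by simp
      from ex_residue_sum_less[OF m this cost]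
      obtain p where p: "p < m"
        and pc: "(\<Sum>l<L. - ln (Q (map (\<lambda>i. u (p + m * l + i)) [0..<m]))) < real n * \<kappa>"
        unfolding L_def by blast
      define v where "v = map u [0..<p + m * L]"
      have vw: "v \<in> words N (p + m * L)"
        unfolding v_def using u by (intro map_upt_in_words) simp
      have "take m (drop (p + m * l) v) = map (\<lambda>i. u (p + m * l + i)) [0..<m]" if "l < L" for l
      proof -
        have "m * Suc l \<le> m * L" using that by (intro mult_le_mono2) simp
        then show ?thesis using that by (intro nth_equalityI) (auto simp: v_def nth_append)
      qed
      then have "Wt p v = (\<Prod>l<L. exp (ln (Q (map (\<lambda>i. u (p + m * l + i)) [0..<m]))))"
        unfolding Wt_def using Q(1)[OF blk] by simp
      also have "\<dots> = exp (- (\<Sum>l<L. - ln (Q (map (\<lambda>i. u (p + m * l + i)) [0..<m]))))"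
        by (simp add: exp_sum sum_negf)
      also have "\<dots> > exp (- real n * \<kappa>)" using pc by simp
      finally have "v \<in> A p" using vw by (simp add: A_def)
      moreover have xcyl: "x \<in> cyl v" using xX u by (simp add: cyl_def v_def)
      ultimately have vB: "v \<in> B" using p by (auto simp: B_def)
      \<comment> \<open>No hypothesis makes the radius positive, but a cheap point forces it; the
        maximum in \<open>dyn_dist\<close> contains 0, which has to be below \<open>eps\<close> as
        well.\<close>
      have pos: "eps > 0" using le_less_trans[OF zero_le_dist u(2)[of 0]] by simp
      have "dyn_dist T (m * L) (z v) x < eps"
        unfolding dyn_dist_def
      proof (subst Max_less_iff; (intro ballI)?)
        fix d assume "d \<in> insert 0 ((\<lambda>j. dist ((T ^^ j) (z v)) ((T ^^ j) x)) ` {..<m * L})"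
        then consider "d = 0" | j where "j < m * L" "d = dist ((T ^^ j) (z v)) ((T ^^ j) x)" by auto
        then show "d < eps"
        proof cases
          case 2
          have "length v = p + m * L" by (simp add: v_def)
          then have "dist (c (v ! j)) ((T^^j) (z v)) < eps / 2" "dist (c (v ! j)) ((T^^j) x) < eps / 2"
            using zcyl[OF vB] xcyl 2(1) by (auto simp: cyl_def)
          then show ?thesis
            unfolding 2(2) by (metis dist_triangle_half_r)
        qed (use pos in simp)
      qed auto
      then have "x \<in> bowen_ball T X (snd (z v, m * L)) (fst (z v, m * L)) eps"
        using xX by (simp add: bowen_ball_def)
      moreover have "(z v, m * L) \<in> C" using vB by (simp add: C_def)
      ultimately show "x \<in> (\<Union>p\<in>C. bowen_ball T X (snd p) (fst p) eps)" by (rule UN_I[rotated])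
    qed
  qed
  also have "\<dots> = (\<Sum>p\<in>C. ennreal (exp (- s * real (snd p))))"
    using finB by (intro nn_integral_count_space_finite) (simp add: C_def)
  also have "\<dots> = (\<Sum>p\<in>C. ennreal (exp (- s * real (m * L))))"
    by (intro sum.cong) (auto simp: C_def)
  also have "\<dots> = ennreal (real (card C) * exp (- s * real (m * L)))"
    by (simp add: ennreal_mult ennreal_of_nat_eq_real_of_nat)
  also have "\<dots> \<le> ennreal (real m * real N ^ m * exp (\<bar>s\<bar> * real m) * exp (- (s - \<kappa>) * real n))"
  proof (rule ennreal_leI)
    have "card C \<le> card B" unfolding C_def by (rule card_image_le[OF finB])
    then have 1: "real (card C) \<le> real m * (real N ^ m * exp (real n * \<kappa>))" using cardB by linarith
    \<comment> \<open>Replacing \<open>m * L\<close> by \<open>n\<close> changes the exponent by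
      fewer than \<open>m\<close> time steps; the absolute value covers either sign of
      \<open>s\<close>.\<close>
    have nn: "n = m * L + n mod m" by (simp add: L_def)
    have "- s * real (m * L) = - s * real n + s * real (n mod m)"
      by (subst nn) (simp add: algebra_simps)
    also have "s * real (n mod m) \<le> \<bar>s\<bar> * real (n mod m)" by (intro mult_right_mono) auto
    also have "\<bar>s\<bar> * real (n mod m) \<le> \<bar>s\<bar> * real m" using m by (intro mult_left_mono) (auto intro: less_imp_le)
    finally have 2: "exp (- s * real (m * L)) \<le> exp (- s * real n + \<bar>s\<bar> * real m)" by simp
    have "real (card C) * exp (- s * real (m * L))
        \<le> (real m * (real N ^ m * exp (real n * \<kappa>))) * exp (- s * real n + \<bar>s\<bar> * real m)"
      by (intro mult_mono 1 2) auto
    also have "\<dots> = real m * real N ^ m * exp (\<bar>s\<bar> * real m) * (exp (real n * \<kappa>) * exp (- s * real n))"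
      by (simp add: mult_exp_exp)
    also have "exp (real n * \<kappa>) * exp (- s * real n) = exp (- (s - \<kappa>) * real n)"
      by (simp add: algebra_simps flip: exp_add)
    finally show "real (card C) * exp (- s * real (m * L))
        \<le> real m * real N ^ m * exp (\<bar>s\<bar> * real m) * exp (- (s - \<kappa>) * real n)" .
  qed
  finally show ?thesis .
qed

text \<open>A Borel--Cantelli argument: at exponent \<open>s > \<kappa>\<close> the costs of
  covering the sets for \<open>n = M, M + 1, ...\<close> are dominated by a geometric series with
  ratio \<open>exp (- (s - \<kappa>))\<close>, whose tail vanishes as \<open>M\<close>
  grows.\<close>

lemma bowen_H_limsup_low_cost:
  fixes Q :: "nat list \<Rightarrow> real"
  assumes N: "N \<ge> 1" and m: "m \<ge> 1" and s: "\<kappa> < s"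
    and Q: "\<And>w. w \<in> words N m \<Longrightarrow> 0 < Q w" "(\<Sum>w\<in>words N m. Q w) \<le> 1"
  shows "bowen_H T X {x. \<exists>\<^sub>\<infinity>n. x \<in> low_cost_points T X c N eps m Q \<kappa> n} s eps = 0"
proof -
  let ?S = "{x. \<exists>\<^sub>\<infinity>n. x \<in> low_cost_points T X c N eps m Q \<kappa> n}"
  define K where "K = real m * real N ^ m * exp (\<bar>s\<bar> * real m)"
  define q where "q = exp (- (s - \<kappa>))"
  have q: "0 < q" "q < 1" and K: "K \<ge> 0" using s by (auto simp: q_def K_def)
  have qn: "exp (- (s - \<kappa>) * real n) = q ^ n" for n
    unfolding q_def by (simp add: mult.commute flip: exp_of_nat_mult)
  have "bowen_Hn T X ?S s eps k = 0" for k
  proof -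
    \<comment> \<open>For \<open>n \<ge> M\<close> the ball length \<open>m * (n div m)\<close>
      falls short of \<open>n\<close> by less than \<open>m\<close>, so \<open>M \<ge> k + m\<close>
      keeps it at least \<open>k\<close>.\<close>
    have le: "bowen_Hn T X ?S s eps k \<le> ennreal (K * q ^ M / (1 - q))" if M: "M \<ge> k + m" for M
    proof -
      have "?S \<subseteq> (\<Union>i. low_cost_points T X c N eps m Q \<kappa> (M + i))"
      proof
        fix x assume "x \<in> ?S"
        then obtain n where "n \<ge> M" "x \<in> low_cost_points T X c N eps m Q \<kappa> n"
          unfolding INFM_nat_le by auto
        then show "x \<in> (\<Union>i. low_cost_points T X c N eps m Q \<kappa> (M + i))"
          by (intro UN_I[of "n - M"]) auto
      qed
      then have "bowen_Hn T X ?S s eps k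
          \<le> bowen_Hn T X (\<Union>i. low_cost_points T X c N eps m Q \<kappa> (M + i)) s eps k"
        by (intro bowen_Hn_mono) auto
      also have "\<dots> \<le> (\<Sum>i. bowen_Hn T X (low_cost_points T X c N eps m Q \<kappa> (M + i)) s eps k)"
        by (rule bowen_Hn_UN_le)
      also have "\<dots> \<le> (\<Sum>i. ennreal (K * q ^ (M + i)))"
      proof (intro suminf_le)
        fix i
        have "k + m \<le> m * ((M + i) div m) + (M + i) mod m" using M by simp
        moreover have "(M + i) mod m \<le> m" using m by (auto intro: less_imp_le)
        ultimately have "k \<le> m * ((M + i) div m)" by linarith
        from bowen_Hn_low_cost_le[OF N m this Q, of T X c eps \<kappa> s]
        show "bowen_Hn T X (low_cost_points T X c N eps m Q \<kappa> (M + i)) s eps k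
            \<le> ennreal (K * q ^ (M + i))"
          unfolding qn K_def .
      qed auto
      also have "\<dots> = ennreal (K * q ^ M / (1 - q))"
      proof (intro suminf_ennreal_eq)
        have "(\<lambda>i. K * q ^ M * q ^ i) sums (K * q ^ M * (1 / (1 - q)))"
          using q by (intro sums_mult geometric_sums) auto
        then show "(\<lambda>i. K * q ^ (M + i)) sums (K * q ^ M / (1 - q))"
          by (simp add: power_add mult.assoc)
      qed (use K q in simp)
      finally show ?thesis .
    qed
    have "(\<lambda>M. ennreal (K * q ^ M / (1 - q))) \<longlonglongrightarrow> ennreal (K * 0 / (1 - q))"
      using q by (intro tendsto_ennrealI tendsto_intros LIMSEQ_power_zero) auto
    then have "bowen_Hn T X ?S s eps k \<le> ennreal (K * 0 / (1 - q))"
      by (rule LIMSEQ_le_const) (use le in auto)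
    then show ?thesis by simp
  qed
  then show ?thesis by (simp add: bowen_H_eq_0_iff)
qed

section \<open>Limits of empirical measures\<close>

text \<open>The sets are the balls of radius \<open>1 / Suc j\<close> around finite nets, over all
  \<open>j\<close>. Membership in the finitely many balls of one fine net already locates a point up
  to \<open>e\<close>.\<close>

lemma ex_separating_sets:
  assumes "compact (X::'a::metric_space set)"
  shows "\<exists>U::nat \<Rightarrow> 'a set. \<forall>e>0. \<exists>n. \<forall>x\<in>X. \<forall>y\<in>X. (\<forall>k\<le>n. x \<in> U k \<longleftrightarrow> y \<in> U k) \<longrightarrow> dist x y < e"
proof -
  have "\<exists>F. finite F \<and> X \<subseteq> (\<Union>c\<in>F. ball c (1 / real (Suc j)))" for j
    using assms unfolding compact_eq_totally_bounded by simp
  then obtain F where F: "\<And>j. finite (F j)" "\<And>j. X \<subseteq> (\<Union>c\<in>F j. ball c (1 / real (Suc j)))"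
    by metis
  \<comment> \<open>The empty set keeps \<open>B\<close> nonempty, so that it can be enumerated even
    when all nets are empty.\<close>
  define B where "B = insert {} (\<Union>j. (\<lambda>c. ball c (1 / real (Suc j))) ` F j)"
  define U where "U = from_nat_into B"
  have "countable B" unfolding B_def using F(1) by (simp add: countable_finite)
  then have U: "range U = B" unfolding U_def by (intro range_from_nat_into) (auto simp: B_def)
  have "\<exists>n. \<forall>x\<in>X. \<forall>y\<in>X. (\<forall>k\<le>n. x \<in> U k \<longleftrightarrow> y \<in> U k) \<longrightarrow> dist x y < e" if "e > 0" for e
  proof -
    obtain j where j: "1 / real (Suc j) < e / 2"
      using \<open>e > 0\<close> nat_approx_posE[of "e / 2"] by auto
    have "(\<lambda>c. ball c (1 / real (Suc j))) ` F j \<subseteq> range U" unfolding U B_def by blast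
    then obtain S where S: "finite S" "(\<lambda>c. ball c (1 / real (Suc j))) ` F j = U ` S"
      using F(1)[of j] by (metis finite_imageI finite_subset_image)
    obtain n where n: "\<And>k. k \<in> S \<Longrightarrow> k \<le> n" using S(1) finite_nat_set_iff_bounded_le by auto
    have "dist x y < e" if x: "x \<in> X" and eq: "\<forall>k\<le>n. x \<in> U k \<longleftrightarrow> y \<in> U k" for x y
    proof -
      obtain c where c: "c \<in> F j" "x \<in> ball c (1 / real (Suc j))" using F(2)[of j] x by blast
      then obtain k where "k \<in> S" "ball c (1 / real (Suc j)) = U k" using S(2) by blast
      then have "y \<in> ball c (1 / real (Suc j))" using eq n c(2) by blast
      then have "dist c x < e / 2" "dist c y < e / 2" using c(2) j by auto
      then show ?thesis by (rule dist_triangle_half_r)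
    qed
    then show ?thesis by blast
  qed
  then show ?thesis by blast
qed

text \<open>At the first disagreement \<open>k0\<close> the digits 0 and 1 make a difference of
  \<open>(1/3)^k0\<close>, of which all later digits can undo at most half. In base 2 they could
  undo all of it.\<close>

lemma ternary_digits_close:
  fixes a b :: "nat \<Rightarrow> real"
  assumes a: "\<And>k. a k \<in> {0, 1}" and b: "\<And>k. b k \<in> {0, 1}"
    and close: "\<bar>(\<Sum>k. a k * (1/3)^k) - (\<Sum>k. b k * (1/3)^k)\<bar> < (1/3)^n / 2" and "k \<le> n"
  shows "a k = b k"
proof (rule ccontr)
  assume "a k \<noteq> b k"
  define k0 where "k0 = (LEAST k. a k \<noteq> b k)"
  have k0: "a k0 \<noteq> b k0" unfolding k0_def by (rule LeastI) fact
  have "k0 \<le> k" unfolding k0_def by (rule Least_le) fact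
  have eq: "a i = b i" if "i < k0" for i using not_less_Least[of i "\<lambda>k. a k \<noteq> b k"] that by (auto simp: k0_def)
  define f where "f k = (a k - b k) * (1/3)^k" for k
  have geo: "summable (\<lambda>k. (1/3::real)^k)" by simp
  have fb: "norm (f k) \<le> (1/3)^k" for k
    using a[of k] b[of k] by (auto simp: f_def abs_mult)
  have "norm (a k * (1/3)^k) \<le> (1/3)^k" "norm (b k * (1/3)^k) \<le> (1/3)^k" for k
    using a[of k] b[of k] by auto
  then have sa: "summable (\<lambda>k. a k * (1/3)^k)" "summable (\<lambda>k. b k * (1/3)^k)"
    by (blast intro: summable_comparison_test'[OF geo, of 0])+
  have sf: "summable f" by (rule summable_comparison_test'[OF geo, of 0]) (use fb in auto)
  have "(\<Sum>k. a k * (1/3)^k) - (\<Sum>k. b k * (1/3)^k) = (\<Sum>k. f k)"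
    using suminf_diff[OF sa] by (simp add: f_def left_diff_distrib)
  also have "\<dots> = (\<Sum>k. f (k + Suc k0)) + (\<Sum>k<Suc k0. f k)"
    by (rule suminf_split_initial_segment[OF sf])
  also have "(\<Sum>k<Suc k0. f k) = f k0"
    using eq by (simp add: f_def)
  finally have *: "(\<Sum>k. a k * (1/3)^k) - (\<Sum>k. b k * (1/3)^k) = (\<Sum>k. f (k + Suc k0)) + f k0" .
  have sums: "(\<lambda>k. (1/3)^Suc k0 * (1/3::real)^k) sums ((1/3)^Suc k0 * (1 / (1 - 1/3)))"
    by (intro sums_mult geometric_sums) auto
  have "norm (\<Sum>k. f (k + Suc k0)) \<le> (\<Sum>k. (1/3)^Suc k0 * (1/3::real)^k)"
  proof (rule norm_suminf_le)
    show "norm (f (k + Suc k0)) \<le> (1/3)^Suc k0 * (1/3::real)^k" for k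
      using fb[of "k + Suc k0"] by (simp add: power_add mult_ac)
  qed (use sums in \<open>auto simp: sums_iff\<close>)
  also have "\<dots> = (1/3)^k0 / 2" using sums by (simp add: sums_iff)
  finally have "\<bar>\<Sum>k. f (k + Suc k0)\<bar> \<le> (1/3)^k0 / 2" by simp
  moreover have "\<bar>f k0\<bar> = (1/3)^k0" using k0 a[of k0] b[of k0] by (auto simp: f_def abs_mult)
  moreover have "(1/3::real)^n \<le> (1/3)^k0" using \<open>k0 \<le> k\<close> \<open>k \<le> n\<close> by (intro power_decreasing) auto
  ultimately show False using close unfolding * by linarith
qed

text \<open>Ternary expansions whose digits record membership in a separating sequence of sets: the coding
  map is not continuous, but its inverse is uniformly continuous and so extends to the closure.\<close>

lemma ex_real_coding:
  fixes X :: "'a::metric_space set"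
  assumes X: "compact X"
  obtains \<phi> :: "'a \<Rightarrow> real" and h :: "real \<Rightarrow> 'a" and K :: "real set"
  where "compact K" "\<phi> ` X \<subseteq> K" "continuous_on K h" "h ` K \<subseteq> X" "\<And>x. x \<in> X \<Longrightarrow> h (\<phi> x) = x"
proof -
  obtain U :: "nat \<Rightarrow> 'a set"
    where U: "\<And>e. e > 0 \<Longrightarrow> \<exists>n. \<forall>x\<in>X. \<forall>y\<in>X. (\<forall>k\<le>n. x \<in> U k \<longleftrightarrow> y \<in> U k) \<longrightarrow> dist x y < e"
    using ex_separating_sets[OF X] by blast
  define \<phi> where "\<phi> x = (\<Sum>k. indicator (U k) x * (1/3::real)^k)" for x
  define K where "K = closure (\<phi> ` X)"
  have sums: "(\<lambda>k. (1/3::real)^k) sums (1 / (1 - 1/3))" by (rule geometric_sums) simp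
  have \<phi>_bd: "\<bar>\<phi> x\<bar> \<le> 3/2" for x
  proof -
    have "norm (\<phi> x) \<le> (\<Sum>k. (1/3::real)^k)"
      unfolding \<phi>_def by (intro norm_suminf_le) (auto simp: indicator_def)
    then show ?thesis using sums by (simp add: sums_iff)
  qed
  have cK: "compact K"
    unfolding K_def compact_closure by (rule boundedI[of _ "3/2"]) (use \<phi>_bd in auto)
  have unif: "\<exists>d>0. \<forall>x\<in>X. \<forall>y\<in>X. \<bar>\<phi> x - \<phi> y\<bar> < d \<longrightarrow> dist x y < e" if "e > 0" for e
  proof -
    obtain n where n: "\<forall>x\<in>X. \<forall>y\<in>X. (\<forall>k\<le>n. x \<in> U k \<longleftrightarrow> y \<in> U k) \<longrightarrow> dist x y < e"
      using U[OF \<open>e > 0\<close>] by blast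
    have "dist x y < e" if "x \<in> X" "y \<in> X" "\<bar>\<phi> x - \<phi> y\<bar> < (1/3)^n / 2" for x y
    proof -
      have "(indicator (U k) x :: real) = indicator (U k) y" if "k \<le> n" for k
        using ternary_digits_close[of "\<lambda>k. indicator (U k) x" "\<lambda>k. indicator (U k) y" n k]
          \<open>\<bar>\<phi> x - \<phi> y\<bar> < (1/3)^n / 2\<close> that by (auto simp: \<phi>_def indicator_def)
      then have "\<forall>k\<le>n. x \<in> U k \<longleftrightarrow> y \<in> U k" by (metis indicator_eq_1_iff)
      then show ?thesis using n that by blast
    qed
    then show ?thesis by (intro exI[of _ "(1/3)^n / 2"]) auto
  qed
  \<comment> \<open>The closure of the graph of the inverse of \<open>\<phi>\<close>, as a relation
    between codes and points.\<close>
  define lim where "lim t y \<longleftrightarrow> y \<in> X \<and> (\<exists>u. (\<forall>k. u k \<in> X) \<and> u \<longlonglongrightarrow> y \<and> (\<lambda>k. \<phi> (u k)) \<longlonglongrightarrow> t)" for t y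
  have ex_lim: "\<exists>y. lim t y" if "t \<in> K" for t
  proof -
    obtain v where v: "\<And>k::nat. v k \<in> \<phi> ` X" "v \<longlonglongrightarrow> t"
      using \<open>t \<in> K\<close> unfolding K_def closure_sequential by blast
    then have "\<exists>u. \<forall>k. u k \<in> X \<and> v k = \<phi> (u k)" by (intro choice) blast
    then obtain u where u: "\<And>k. u k \<in> X" "\<And>k. v k = \<phi> (u k)" by blast
    obtain y r where y: "y \<in> X" "strict_mono (r::nat \<Rightarrow> nat)" "(u \<circ> r) \<longlonglongrightarrow> y"
      using X u(1) unfolding compact_def by blast
    have "(v \<circ> r) \<longlonglongrightarrow> t" using v(2) y(2) by (rule LIMSEQ_subseq_LIMSEQ)
    then have "lim t y"
      unfolding lim_def using u y by (intro conjI exI[of _ "u \<circ> r"]) (auto simp: o_def)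
    then show ?thesis by blast
  qed
  \<comment> \<open>One modulus of continuity serves the whole relation, and the case
    \<open>t = t'\<close> makes it single-valued. The limit turns \<open><\<close> into
    \<open>\<le>\<close>, hence the halved \<open>e\<close>.\<close>
  have close: "\<exists>d>0. \<forall>t y t' y'. lim t y \<longrightarrow> lim t' y' \<longrightarrow> \<bar>t - t'\<bar> < d \<longrightarrow> dist y y' < e" if "e > 0" for e
  proof -
    obtain d where d: "d > 0" "\<forall>x\<in>X. \<forall>y\<in>X. \<bar>\<phi> x - \<phi> y\<bar> < d \<longrightarrow> dist x y < e / 2"
      using unif[of "e / 2"] \<open>e > 0\<close> by auto
    have "dist y y' < e" if "lim t y" "lim t' y'" and tt: "\<bar>t - t'\<bar> < d" for t y t' y'
    proof -
      obtain u u' where u: "\<And>k. u k \<in> X" "u \<longlonglongrightarrow> y" "(\<lambda>k. \<phi> (u k)) \<longlonglongrightarrow> t"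
        and u': "\<And>k. u' k \<in> X" "u' \<longlonglongrightarrow> y'" "(\<lambda>k. \<phi> (u' k)) \<longlonglongrightarrow> t'"
        using \<open>lim t y\<close> \<open>lim t' y'\<close> unfolding lim_def by blast
      have "(\<lambda>k. \<bar>\<phi> (u k) - \<phi> (u' k)\<bar>) \<longlonglongrightarrow> \<bar>t - t'\<bar>" by (intro tendsto_intros u u')
      then have ev: "\<forall>\<^sub>F k in sequentially. \<bar>\<phi> (u k) - \<phi> (u' k)\<bar> < d" using tt by (rule order_tendstoD)
      have "dist y y' \<le> e / 2"
      proof (rule tendsto_upperbound)
        show "(\<lambda>k. dist (u k) (u' k)) \<longlonglongrightarrow> dist y y'" by (intro tendsto_intros u u')
        show "\<forall>\<^sub>F k in sequentially. dist (u k) (u' k) \<le> e / 2"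
          using ev by eventually_elim (use d(2) u(1) u'(1) in \<open>auto intro: less_imp_le\<close>)
      qed simp
      then show ?thesis using \<open>e > 0\<close> by simp
    qed
    then show ?thesis using d(1) by blast
  qed
  define h where "h t = (SOME y. lim t y)" for t
  have h: "lim t (h t)" if "t \<in> K" for t
    unfolding h_def using ex_lim[OF that] by (rule someI_ex)
  have cont: "continuous_on K h"
    unfolding continuous_on_iff
  proof (intro ballI allI impI)
    fix t and e :: real assume t: "t \<in> K" "e > 0"
    then obtain d where d: "d > 0" "\<And>t y t' y'. lim t y \<Longrightarrow> lim t' y' \<Longrightarrow> \<bar>t - t'\<bar> < d \<Longrightarrow> dist y y' < e"
      using close by blast
    show "\<exists>d>0. \<forall>t'\<in>K. dist t' t < d \<longrightarrow> dist (h t') (h t) < e"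
      using d(1) by (intro exI[of _ d] conjI ballI impI d(2)[OF h h[OF t(1)]]) (auto simp: dist_real_def)
  qed
  have hK: "h ` K \<subseteq> X" using h by (auto simp: lim_def)
  have \<phi>K: "\<phi> ` X \<subseteq> K" unfolding K_def by (rule closure_subset)
  have inv: "h (\<phi> x) = x" if x: "x \<in> X" for x
  proof (rule ccontr)
    assume "h (\<phi> x) \<noteq> x"
    then obtain d where d: "d > 0" "\<forall>t y t' y'. lim t y \<longrightarrow> lim t' y' \<longrightarrow> \<bar>t - t'\<bar> < d \<longrightarrow> dist y y' < dist (h (\<phi> x)) x"
      using close[of "dist (h (\<phi> x)) x"] by auto
    have "lim (\<phi> x) x" unfolding lim_def using x by (intro conjI exI[of _ "\<lambda>_. x"]) auto
    moreover have "lim (\<phi> x) (h (\<phi> x))" using h x \<phi>K by blast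
    ultimately show False using d by (metis diff_self abs_zero less_irrefl)
  qed
  show thesis by (rule that[OF cK \<phi>K cont hK inv])
qed

section \<open>Weak-star limits of empirical measures\<close>

text \<open>Weak-star convergence of the empirical measures of \<open>c\<close> along the lengths
  \<open>\<sigma>\<close>; with an orbit for \<open>c\<close> and the identity for
  \<open>\<sigma>\<close> this is genericity.\<close>

definition averages_to :: "'a::metric_space set \<Rightarrow> (nat \<Rightarrow> 'a) \<Rightarrow> (nat \<Rightarrow> nat) \<Rightarrow> 'a measure \<Rightarrow> bool" where
  "averages_to X c \<sigma> M \<longleftrightarrow> (\<forall>f::'a \<Rightarrow> real. continuous_on X f \<longrightarrow>
     (\<lambda>k. (\<Sum>j<\<sigma> k. f (c j)) / real (\<sigma> k)) \<longlonglongrightarrow> integral\<^sup>L M f)"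

lemma borel_measurable_continuous_on_carrier:
  assumes "sets M = sets (restrict_space borel X)" "continuous_on X f"
  shows "f \<in> borel_measurable M"
  using borel_measurable_continuous_on_restrict[OF assms(2)] assms(1)
  by (simp cong: measurable_cong_sets)

lemma space_restrict_borel: "sets M = sets (restrict_space borel X) \<Longrightarrow> space M = X"
  using sets_eq_imp_space_eq[of M "restrict_space borel X"] by (simp add: space_restrict_space)

lemma compact_continuous_bounded:
  assumes "compact X" "continuous_on X (f :: _ \<Rightarrow> real)"
  obtains B where "\<And>x. x \<in> X \<Longrightarrow> \<bar>f x\<bar> \<le> B"
  using compact_imp_bounded[OF compact_continuous_image[OF assms(2,1)]]
  by (auto simp: bounded_iff)

text \<open>Helly selection on the line, carried over by the coding: tightness is automatic because
  all codes lie in the compact \<open>K\<close>, and the limit is brought back by \<open>h\<close>.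
  Test functions move to the line through \<open>h\<close>, which is continuous, not through
  \<open>\<phi>\<close>.\<close>

lemma ex_averages_to:
  assumes X: "compact (X::'a::metric_space set)" and c: "\<And>j. c j \<in> X"
  shows "\<exists>\<sigma> M. strict_mono \<sigma> \<and> prob_space M \<and> sets M = sets (restrict_space borel X) \<and> averages_to X c \<sigma> M"
proof -
  obtain \<phi> :: "'a \<Rightarrow> real" and h K where K: "compact K" "\<phi> ` X \<subseteq> K" "continuous_on K h" "h ` K \<subseteq> X" "\<And>x. x \<in> X \<Longrightarrow> h (\<phi> x) = x"
    by (rule ex_real_coding[OF X]) (rule that)
  have ne: "K \<noteq> {}" "closed K" using c K by (auto simp: compact_imp_closed)
  \<comment> \<open>A uniform distribution needs a nonempty set, so the index set is
    \<open>{..n}\<close>; hence the lengths \<open>Suc (r k)\<close> below.\<close>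
  define \<nu> where "\<nu> n = distr (measure_pmf (pmf_of_set {..n})) borel (\<lambda>j. \<phi> (c j))" for n :: nat
  have int: "integral\<^sup>L (\<nu> n) g = (\<Sum>j<Suc n. g (\<phi> (c j))) / real (Suc n)" if "g \<in> borel_measurable borel" for g :: "real \<Rightarrow> real" and n
    unfolding \<nu>_def using that
    by (subst integral_distr) (simp_all add: integral_pmf_of_set lessThan_Suc_atMost)
  have rd: "real_distribution (\<nu> n)" for n
    unfolding \<nu>_def real_distribution_def real_distribution_axioms_def
    by (auto intro!: prob_space.prob_space_distr measure_pmf.prob_space_axioms)
  obtain R where R: "\<And>t. t \<in> K \<Longrightarrow> \<bar>t\<bar> \<le> R" using compact_imp_bounded[OF K(1)] by (auto simp: bounded_iff)
  have R0: "R \<ge> 0" using ne(1) R by (meson abs_ge_zero all_not_in_conv order_trans)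
  have "tight \<nu>"
    unfolding tight_def
  proof (intro conjI allI impI rd)
    fix e :: real assume e: "e > 0"
    have "measure (\<nu> n) {- R - 1<..R + 1} = 1" for n
    proof -
      have "\<phi> (c j) \<in> {- R - 1<..R + 1}" for j
      proof -
        have "\<phi> (c j) \<in> K" using c K(2) by blast
        from R[OF this] show ?thesis by auto
      qed
      then have "(\<lambda>j. \<phi> (c j)) -` {- R - 1<..R + 1} = UNIV" by blast
      then show ?thesis unfolding \<nu>_def by (subst measure_distr) auto
    qed
    then show "\<exists>a b. a < b \<and> (\<forall>n. 1 - e < measure (\<nu> n) {a<..b})"
      using e R0 by (intro exI[of _ "-R-1"] exI[of _ "R+1"]) auto
  qed
  from tight_imp_convergent_subsubsequence[OF this strict_mono_id]
  obtain r N where r: "strict_mono r" and N: "real_distribution N" and wc: "weak_conv_m (\<nu> \<circ> id \<circ> r) N"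
    by blast
  interpret N: real_distribution N by fact
  have conv: "(\<lambda>k. (\<Sum>j<Suc (r k). g (\<phi> (c j))) / real (Suc (r k))) \<longlonglongrightarrow> integral\<^sup>L N g"
    if g: "continuous_on UNIV g" "\<And>t. \<bar>g t\<bar> \<le> B" for g :: "real \<Rightarrow> real" and B
  proof -
    have "(\<lambda>k. integral\<^sup>L ((\<nu> \<circ> id \<circ> r) k) g) \<longlonglongrightarrow> integral\<^sup>L N g"
      by (rule weak_conv_imp_integral_bdd_continuous_conv[where B = B])
        (use rd N wc g in \<open>auto simp: continuous_on_eq_continuous_at o_def\<close>)
    moreover have "g \<in> borel_measurable borel" using g(1) by (rule borel_measurable_continuous_onI)
    ultimately show ?thesis by (simp only: o_def id_def int)
  qed
  \<comment> \<open>A bounded continuous function vanishing exactly on \<open>K\<close>: its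
    averages along the codes are 0, so its integral is 0 in the limit and \<open>N\<close> is
    carried by \<open>K\<close>.\<close>
  define d where "d t = min 1 (infdist t K)" for t
  have d: "continuous_on UNIV d" "\<And>t. \<bar>d t\<bar> \<le> 1" "\<And>t. d t \<ge> 0" "\<And>t. d t = 0 \<longleftrightarrow> t \<in> K"
    unfolding d_def using ne by (auto intro!: continuous_intros simp: infdist_nonneg in_closed_iff_infdist_zero)
  have "(\<lambda>k. (\<Sum>j<Suc (r k). d (\<phi> (c j))) / real (Suc (r k))) = (\<lambda>k. 0)"
  proof -
    have "d (\<phi> (c j)) = 0" for j using c K(2) d(4) by blast
    then show ?thesis by simp
  qed
  with conv[OF d(1,2)] have "integral\<^sup>L N d = 0"
    by (simp add: LIMSEQ_const_iff)
  moreover have "d \<in> borel_measurable borel" using d(1) by (rule borel_measurable_continuous_onI)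
  then have "integrable N d"
    using d(2) by (intro N.integrable_const_bound[where B = 1]) auto
  ultimately have "AE t in N. d t = 0"
    using d(3) by (subst (asm) integral_nonneg_eq_0_iff_AE) auto
  then have AEK: "AE t in N. t \<in> K" by (simp add: d(4))
  define h' where "h' t = (if t \<in> K then h t else c 0)" for t
  have h'X: "h' t \<in> X" for t using K(4) c by (auto simp: h'_def)
  have [measurable]: "h' \<in> measurable N (restrict_space borel X)"
  proof (rule measurable_restrict_space2)
    have "h' \<in> borel_measurable borel"
      unfolding h'_def using ne(2) K(3) by (intro borel_measurable_continuous_on_if) auto
    then show "h' \<in> borel_measurable N" by simp
  qed (use h'X in auto)
  define M where "M = distr N (restrict_space borel X) h'"
  have "averages_to X c (\<lambda>k. Suc (r k)) M"
    unfolding averages_to_def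
  proof (intro allI impI)
    fix f :: "'a \<Rightarrow> real" assume f: "continuous_on X f"
    then obtain B where B: "\<And>x. x \<in> X \<Longrightarrow> \<bar>f x\<bar> \<le> B" using compact_continuous_bounded[OF X] by metis
    have "B \<ge> 0" using B[OF c[of 0]] by simp
    have "continuous_on K (f \<circ> h)"
      using K(3,4) f by (intro continuous_on_compose) (auto intro: continuous_on_subset)
    moreover have "closedin (top_of_set UNIV) K" using ne by simp
    \<comment> \<open>Weak convergence tests with functions on the whole line, so
      \<open>f \<circ> h\<close> is extended from \<open>K\<close> with the same bound.\<close>
    ultimately obtain g where g: "continuous_on UNIV g" "\<And>t. t \<in> K \<Longrightarrow> g t = (f \<circ> h) t" "\<And>t. norm (g t) \<le> B"
      using Tietze[of K "f \<circ> h" UNIV B] \<open>B \<ge> 0\<close> B K(4) by (metis UNIV_I comp_apply image_subset_iff real_norm_def)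
    have [measurable]: "f \<in> borel_measurable (restrict_space borel X)" "g \<in> borel_measurable borel"
      using f g(1) by (auto intro: borel_measurable_continuous_on_restrict borel_measurable_continuous_onI)
    have "integral\<^sup>L M f = (\<integral>t. f (h' t) \<partial>N)"
      unfolding M_def by (intro integral_distr) auto
    also have "\<dots> = integral\<^sup>L N g"
    proof (rule integral_cong_AE)
      show "(\<lambda>t. f (h' t)) \<in> borel_measurable N" by measurable
      show "AE t in N. f (h' t) = g t" using AEK by eventually_elim (simp add: h'_def g(2))
    qed simp
    finally have "integral\<^sup>L M f = integral\<^sup>L N g" .
    moreover have "g (\<phi> (c j)) = f (c j)" for j
    proof -
      have "\<phi> (c j) \<in> K" using c K(2) by blast
      then show ?thesis using g(2) K(5)[OF c] by simp
    qed
    ultimately show "(\<lambda>k. (\<Sum>j<Suc (r k). f (c j)) / real (Suc (r k))) \<longlonglongrightarrow> integral\<^sup>L M f"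
      using conv[OF g(1), of B] g(3) by simp
  qed
  moreover have "prob_space M" unfolding M_def by (intro N.prob_space_distr) simp
  moreover have "sets M = sets (restrict_space borel X)" by (simp add: M_def)
  moreover have "strict_mono (\<lambda>k. Suc (r k))" using r by (simp add: strict_mono_def)
  ultimately show ?thesis by blast
qed

section \<open>Closed sets tested by continuous functions\<close>

text \<open>Lipschitz functions decreasing to the indicator of a closed nonempty \<open>F\<close>.
  For \<open>F = {}\<close> they are constantly 1, because \<open>infdist\<close> is 0 there, so the
  empty set is split off in what follows.\<close>

definition bump :: "'a::metric_space set \<Rightarrow> nat \<Rightarrow> 'a \<Rightarrow> real" where
  "bump F k y = max 0 (1 - real k * infdist y F)"

lemma bump_bounds: "0 \<le> bump F k y" "bump F k y \<le> 1"
  by (auto simp: bump_def infdist_nonneg)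

lemma continuous_on_bump: "continuous_on X (bump F k)"
  unfolding bump_def by (intro continuous_intros)

lemma indicator_le_bump: "indicator F y \<le> bump F k y"
  by (auto simp: bump_def indicator_def)

lemma bump_tendsto_indicator:
  assumes "closed F" "F \<noteq> {}"
  shows "(\<lambda>k. bump F k y) \<longlonglongrightarrow> indicator F y"
proof (cases "y \<in> F")
  case True
  then show ?thesis by (simp add: bump_def)
next
  case False
  then have pos: "infdist y F > 0"
    using assms infdist_nonneg[of y F] in_closed_iff_infdist_zero[of F y] by linarith
  obtain k0 :: nat where k0: "1 < real k0 * infdist y F" using pos reals_Archimedean3 by blast
  have "bump F k y = 0" if "k \<ge> k0" for k
  proof -
    have "real k0 * infdist y F \<le> real k * infdist y F" using that pos by (intro mult_right_mono) auto
    then show ?thesis using k0 by (simp add: bump_def)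
  qed
  then have "\<forall>\<^sub>F k in sequentially. bump F k y = indicator F y"
    using False by (auto simp: eventually_sequentially)
  then show ?thesis by (rule tendsto_eventually)
qed

lemma integral_bump_tendsto:
  assumes M: "prob_space M" "sets M = sets (restrict_space borel X)" and F: "closed F" "F \<noteq> {}" "F \<subseteq> X"
  shows "(\<lambda>k. integral\<^sup>L M (bump F k)) \<longlonglongrightarrow> measure M F"
proof -
  interpret prob_space M by fact
  have FM: "F \<in> sets M"
    using F unfolding M(2) by (auto simp: sets_restrict_space intro!: image_eqI[of _ _ F])
  have "(\<lambda>k. integral\<^sup>L M (bump F k)) \<longlonglongrightarrow> integral\<^sup>L M (indicator F)"
  proof (rule integral_dominated_convergence[where w = "\<lambda>_. 1"])
    show "bump F k \<in> borel_measurable M" for k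
      using M(2) continuous_on_bump by (rule borel_measurable_continuous_on_carrier)
  qed (use FM bump_bounds[of F] bump_tendsto_indicator[OF F(1,2)] in auto)
  then show ?thesis using FM by simp
qed

text \<open>Bumps determine the measures of closed sets, an intersection-stable generator of the
  Borel sets. Both measures are pushed to \<open>borel\<close> on the whole type, where that
  generator lives.\<close>

lemma prob_measure_eqI_continuous:
  assumes X: "closed X"
    and M: "prob_space M" "sets M = sets (restrict_space borel X)"
    and N: "prob_space N" "sets N = sets (restrict_space borel X)"
    and eq: "\<And>f::'a::metric_space \<Rightarrow> real. continuous_on X f \<Longrightarrow> (\<And>y. \<bar>f y\<bar> \<le> 1) \<Longrightarrow> integral\<^sup>L M f = integral\<^sup>L N f"
  shows "M = N"
proof -
  interpret M: prob_space M by fact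
  interpret N: prob_space N by fact
  have eqF: "measure M F = measure N F" if F: "closed F" "F \<subseteq> X" for F
  proof (cases "F = {}")
    case False
    have "integral\<^sup>L M (bump F k) = integral\<^sup>L N (bump F k)" for k
      using bump_bounds[of F k] continuous_on_bump by (intro eq) (auto simp: abs_le_iff intro: order_trans[of _ 0])
    with integral_bump_tendsto[OF M F(1) False F(2)] integral_bump_tendsto[OF N F(1) False F(2)]
    show ?thesis by (simp add: LIMSEQ_unique)
  qed simp
  have spM: "space M = X" and spN: "space N = X" using M(2) N(2) space_restrict_borel by metis+
  have idM: "(\<lambda>x. x) \<in> measurable M borel" and idN: "(\<lambda>x. x) \<in> measurable N borel"
    using M(2) N(2) by (auto intro!: borel_measurable_continuous_on_carrier)
  have "distr M borel (\<lambda>x. x) = distr N borel (\<lambda>x. x)"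
  proof (rule measure_eqI_generator_eq[where E = "Collect closed" and \<Omega> = UNIV and A = "\<lambda>_. UNIV"])
    fix F :: "'a set" assume "F \<in> Collect closed"
    then have F: "closed F" by simp
    then have "measure M (F \<inter> X) = measure N (F \<inter> X)" using X by (intro eqF) auto
    then show "emeasure (distr M borel (\<lambda>x. x)) F = emeasure (distr N borel (\<lambda>x. x)) F"
      using F idM idN by (simp add: emeasure_distr spM spN M.emeasure_eq_measure N.emeasure_eq_measure)
  next
    show "emeasure (distr M borel (\<lambda>x. x)) UNIV \<noteq> \<infinity>"
      using idM by (simp add: emeasure_distr)
  qed (auto simp: Int_stable_def borel_eq_closed)
  then have eqd: "emeasure (distr M borel (\<lambda>x. x)) A = emeasure (distr N borel (\<lambda>x. x)) A" for A by simp
  show ?thesis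
  proof (rule measure_eqI)
    show "sets M = sets N" using M N by simp
    fix A assume A: "A \<in> sets M"
    then have "A \<in> sets borel" "A \<subseteq> X"
      using X unfolding M(2) by (auto simp: sets_restrict_space)
    then show "emeasure M A = emeasure N A"
      using eqd[of A] idM idN by (simp add: emeasure_distr spM spN Int_absorb2)
  qed
qed

text \<open>The closed-set half of the portmanteau theorem: the indicator of \<open>F\<close> lies
  below a bump whose integral is within \<open>e\<close> of the measure of \<open>F\<close>, and the
  averages of the bump converge.\<close>

lemma averages_to_closed:
  assumes M: "prob_space M" "sets M = sets (restrict_space borel X)" and F: "closed F" "F \<subseteq> X"
    and av: "averages_to X c \<sigma> M" and "e > 0"
  shows "\<forall>\<^sub>F k in sequentially. (\<Sum>j<\<sigma> k. indicator F (c j)) / real (\<sigma> k) < measure M F + e"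
proof (cases "F = {}")
  case False
  have "\<forall>\<^sub>F i in sequentially. integral\<^sup>L M (bump F i) < measure M F + e"
    using integral_bump_tendsto[OF M F(1) False F(2)] \<open>e > 0\<close> by (intro order_tendstoD) auto
  then obtain i where i: "integral\<^sup>L M (bump F i) < measure M F + e"
    by (auto simp: eventually_sequentially)
  have "(\<lambda>k. (\<Sum>j<\<sigma> k. bump F i (c j)) / real (\<sigma> k)) \<longlonglongrightarrow> integral\<^sup>L M (bump F i)"
    using av continuous_on_bump unfolding averages_to_def by blast
  then have "\<forall>\<^sub>F k in sequentially. (\<Sum>j<\<sigma> k. bump F i (c j)) / real (\<sigma> k) < measure M F + e"
    using i by (rule order_tendstoD)
  then show ?thesis
  proof eventually_elim
    case (elim k)
    have "(\<Sum>j<\<sigma> k. indicator F (c j)) / real (\<sigma> k) \<le> (\<Sum>j<\<sigma> k. bump F i (c j)) / real (\<sigma> k)"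
      by (intro divide_right_mono sum_mono indicator_le_bump) simp
    then show ?case using elim by linarith
  qed
qed (use \<open>e > 0\<close> in simp)

section \<open>Invariance of the limit measures of an orbit\<close>

locale compact_system =
  fixes X :: "'a::metric_space set" and T :: "'a \<Rightarrow> 'a"
  assumes compact_X: "compact X" and continuous_T: "continuous_on X T" and T_X: "T ` X \<subseteq> X"
begin

lemma iter_in_X: "x \<in> X \<Longrightarrow> (T ^^ n) x \<in> X"
  using T_X by (induction n) auto

lemma continuous_on_iter: "continuous_on X (T ^^ n)"
proof (induction n)
  case (Suc n)
  have "continuous_on X (T \<circ> (T ^^ n))"
    using Suc continuous_T iter_in_X by (intro continuous_on_compose) (auto intro: continuous_on_subset)
  then show ?case by simp
qed (simp add: id_def)

lemma closed_X: "closed X"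
  using compact_X by (rule compact_imp_closed)

lemma T_measurable: "sets M = sets (restrict_space borel X) \<Longrightarrow> T \<in> measurable M M"
proof -
  assume M: "sets M = sets (restrict_space borel X)"
  then have "T \<in> measurable M (restrict_space borel X)"
    using borel_measurable_continuous_on_carrier[OF M continuous_T] T_X space_restrict_borel[OF M]
    by (intro measurable_restrict_space2) auto
  then show ?thesis using M by (simp cong: measurable_cong_sets)
qed

text \<open>The Krylov--Bogolyubov argument: along an orbit the sums of \<open>f\<close> and of
  \<open>f \<circ> T\<close> telescope to a difference of at most 2, for test functions bounded by
  1, and the length tends to infinity.\<close>

lemma averages_to_invariant:
  assumes M: "prob_space M" "sets M = sets (restrict_space borel X)" and x: "x \<in> X"
    and av: "averages_to X (\<lambda>j. (T ^^ j) x) \<sigma> M" and \<sigma>: "strict_mono \<sigma>"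
  shows "M \<in> Minv X T"
proof -
  interpret prob_space M by fact
  have T: "T \<in> measurable M M" by (rule T_measurable[OF M(2)])
  have "distr M M T = M"
  proof (rule prob_measure_eqI_continuous[OF closed_X])
    show "prob_space (distr M M T)" using T by (rule prob_space_distr)
    fix f :: "'a \<Rightarrow> real" assume f: "continuous_on X f" "\<And>y. \<bar>f y\<bar> \<le> 1"
    have fT: "continuous_on X (\<lambda>y. f (T y))"
      using continuous_on_compose2[OF f(1) continuous_T T_X] .
    have "(\<lambda>k. (\<Sum>j<\<sigma> k. f (T ((T ^^ j) x))) / real (\<sigma> k)) \<longlonglongrightarrow> (\<integral>y. f (T y) \<partial>M)"
      using av fT unfolding averages_to_def by blast
    moreover have "(\<lambda>k. (\<Sum>j<\<sigma> k. f (T ((T ^^ j) x))) / real (\<sigma> k)) \<longlonglongrightarrow> integral\<^sup>L M f + 0"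
    proof -
      have eq: "(\<Sum>j<n. f (T ((T ^^ j) x))) = (\<Sum>j<n. f ((T ^^ j) x)) + (f ((T ^^ n) x) - f x)" for n
        by (induction n) auto
      have lim: "(\<lambda>k. (f ((T ^^ \<sigma> k) x) - f x) / real (\<sigma> k)) \<longlonglongrightarrow> 0"
      proof (rule Lim_null_comparison)
        show "\<forall>\<^sub>F k in sequentially. norm ((f ((T ^^ \<sigma> k) x) - f x) / real (\<sigma> k)) \<le> 2 * inverse (real (\<sigma> k))"
        proof (intro always_eventually allI)
          fix k
          have "\<bar>f ((T ^^ \<sigma> k) x) - f x\<bar> \<le> 2" using f(2)[of x] f(2)[of "(T ^^ \<sigma> k) x"] by linarith
          then show "norm ((f ((T ^^ \<sigma> k) x) - f x) / real (\<sigma> k)) \<le> 2 * inverse (real (\<sigma> k))"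
            by (simp add: divide_inverse abs_mult mult_right_mono)
        qed
        have "(\<lambda>n. 2 * inverse (real n)) \<longlonglongrightarrow> 2 * 0" by (intro tendsto_intros lim_inverse_n)
        from LIMSEQ_subseq_LIMSEQ[OF this \<sigma>]
        show "(\<lambda>k. 2 * inverse (real (\<sigma> k))) \<longlonglongrightarrow> 0" by (simp add: o_def)
      qed
      have "(\<lambda>k. (\<Sum>j<\<sigma> k. f ((T ^^ j) x)) / real (\<sigma> k)) \<longlonglongrightarrow> integral\<^sup>L M f"
        using av f unfolding averages_to_def by blast
      from tendsto_add[OF this lim] show ?thesis unfolding eq add_divide_distrib .
    qed
    ultimately have "(\<integral>y. f (T y) \<partial>M) = integral\<^sup>L M f" by (simp add: LIMSEQ_unique)
    then show "integral\<^sup>L (distr M M T) f = integral\<^sup>L M f"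
      using T borel_measurable_continuous_on_carrier[OF M(2) f(1)] by (simp add: integral_distr)
  qed (use M in auto)
  then show ?thesis using M T by (simp add: Minv_def)
qed

lemma ex_limit_measure:
  assumes x: "x \<in> X"
  shows "\<exists>\<sigma>. \<exists>M\<in>Minv X T. strict_mono \<sigma> \<and> averages_to X (\<lambda>j. (T ^^ j) x) \<sigma> M"
proof -
  obtain \<sigma> M where "strict_mono \<sigma>" "prob_space M" "sets M = sets (restrict_space borel X)"
    "averages_to X (\<lambda>j. (T ^^ j) x) \<sigma> M"
    using ex_averages_to[OF compact_X, of "\<lambda>j. (T ^^ j) x"] iter_in_X[OF x] by metis
  then show ?thesis using averages_to_invariant x by metis
qed

end

section \<open>Entropy of blocks\<close>

text \<open>Fekete's lemma: the limit is the infimum \<open>L\<close> of the quotients, finite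
  because they are nonnegative. It is wanted because \<open>ks_entropy_part\<close> is a
  \<open>lim\<close>, of use only once convergence is known.\<close>

lemma convergent_subadditive:
  fixes u :: "nat \<Rightarrow> real"
  assumes nn: "\<And>n. 0 \<le> u n" and sub: "\<And>m n. u (m + n) \<le> u m + u n"
  shows "convergent (\<lambda>n. u n / real n)"
proof -
  define L where "L = (INF n\<in>{1..}. u n / real n)"
  have bdd: "bdd_below ((\<lambda>n. u n / real n) ` {1..})" by (rule bdd_belowI[of _ 0]) (auto simp: nn)
  have L_le: "L \<le> u n / real n" if "n \<ge> 1" for n
    unfolding L_def using bdd that by (intro cINF_lower) auto
  have mult: "u (q * m + s) \<le> real q * u m + u s" for q m s
  proof (induction q)
    case (Suc q)
    have "u (Suc q * m + s) \<le> u m + u (q * m + s)" using sub[of m "q * m + s"] by (simp add: add.assoc)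
    then show ?case using Suc by (simp add: algebra_simps)
  qed simp
  have "(\<lambda>n. u n / real n) \<longlonglongrightarrow> L"
  proof (rule order_tendstoI)
    fix a assume "a < L"
    then show "\<forall>\<^sub>F n in sequentially. a < u n / real n"
      using L_le by (intro eventually_sequentiallyI[of 1]) (auto intro: less_le_trans)
  next
    fix a assume "L < a"
    then obtain m where m: "m \<ge> 1" "u m / real m < a"
      using bdd unfolding L_def by (subst (asm) cINF_less_iff) auto
    define C where "C = (\<Sum>s<m. u s)"
    have le: "u n / real n \<le> u m / real m + C / real n" if "n \<ge> 1" for n
    proof -
      have "u n \<le> real (n div m) * u m + u (n mod m)" using mult[of "n div m" m "n mod m"] by simp
      moreover have "u (n mod m) \<le> C"
        unfolding C_def using m nn by (intro member_le_sum) auto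
      moreover have "real (n div m) * u m \<le> real n * (u m / real m)"
      proof -
        have "real (n div m) \<le> real n / real m" by (rule of_nat_div_le_of_nat)
        then have "real (n div m) * u m \<le> real n / real m * u m" using nn by (intro mult_right_mono) auto
        then show ?thesis by simp
      qed
      ultimately have "u n \<le> real n * (u m / real m) + C" by linarith
      then have "u n / real n \<le> (real n * (u m / real m) + C) / real n" by (rule divide_right_mono) simp
      then show ?thesis using that by (simp add: add_divide_distrib)
    qed
    have "(\<lambda>n. u m / real m + C * inverse (real n)) \<longlonglongrightarrow> u m / real m + C * 0"
      by (intro tendsto_intros lim_inverse_n)
    then have "\<forall>\<^sub>F n in sequentially. u m / real m + C * inverse (real n) < a"
      by (rule order_tendstoD) (use m in simp)
    then show "\<forall>\<^sub>F n in sequentially. u n / real n < a"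
      using eventually_ge_at_top[of 1] by eventually_elim (use le in \<open>auto simp: divide_inverse intro: le_less_trans\<close>)
  qed
  then show ?thesis by (rule convergentI)
qed

text \<open>Nonnegativity of mutual information, by \<open>ln x \<le> x - 1\<close> for
  \<open>x = p1 v * p2 w / p v w\<close> where the denominator is not 0.\<close>

lemma entropy_subadditive:
  fixes p :: "'a \<Rightarrow> 'b \<Rightarrow> real"
  assumes fin: "finite A" "finite B" and nn: "\<And>v w. v \<in> A \<Longrightarrow> w \<in> B \<Longrightarrow> 0 \<le> p v w"
    and p1: "\<And>v. v \<in> A \<Longrightarrow> (\<Sum>w\<in>B. p v w) = p1 v" and p2: "\<And>w. w \<in> B \<Longrightarrow> (\<Sum>v\<in>A. p v w) = p2 w"
    and s1: "(\<Sum>v\<in>A. p1 v) = 1"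
  shows "- (\<Sum>v\<in>A. \<Sum>w\<in>B. p v w * ln (p v w)) \<le> - (\<Sum>v\<in>A. p1 v * ln (p1 v)) - (\<Sum>w\<in>B. p2 w * ln (p2 w))"
proof -
  have s: "(\<Sum>v\<in>A. \<Sum>w\<in>B. p v w) = 1" using p1 s1 by simp
  have s2: "(\<Sum>w\<in>B. p2 w) = 1"
  proof -
    have "(\<Sum>w\<in>B. p2 w) = (\<Sum>w\<in>B. \<Sum>v\<in>A. p v w)" using p2 by simp
    also have "\<dots> = 1" by (subst sum.swap) (rule s)
    finally show ?thesis .
  qed
  have pt: "p v w * ln (p1 v) + p v w * ln (p2 w) - p v w * ln (p v w) \<le> p1 v * p2 w - p v w"
    if v: "v \<in> A" and w: "w \<in> B" for v w
  proof (cases "p v w = 0")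
    case True
    have "0 \<le> p1 v" "0 \<le> p2 w" using p1[OF v] p2[OF w] nn v w by (metis sum_nonneg)+
    then show ?thesis using True by simp
  next
    case False
    then have pos: "p v w > 0" using nn[OF v w] by simp
    have "p v w \<le> p1 v" unfolding p1[OF v, symmetric] using nn v w fin by (intro member_le_sum) auto
    moreover have "p v w \<le> p2 w"
      unfolding p2[OF w, symmetric] using nn v w fin by (intro member_le_sum[of v A "\<lambda>v. p v w"]) auto
    ultimately have pos': "p1 v > 0" "p2 w > 0" using pos by linarith+
    have "ln (p1 v) + ln (p2 w) - ln (p v w) = ln (p1 v * p2 w / p v w)"
      using pos pos' by (simp add: ln_mult ln_div)
    also have "\<dots> \<le> p1 v * p2 w / p v w - 1" using pos pos' by (intro ln_le_minus_one) auto
    finally have "p v w * (ln (p1 v) + ln (p2 w) - ln (p v w)) \<le> p v w * (p1 v * p2 w / p v w - 1)"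
      using pos by (intro mult_left_mono) auto
    then show ?thesis using pos by (simp add: algebra_simps)
  qed
  have "(\<Sum>v\<in>A. \<Sum>w\<in>B. p v w * ln (p1 v) + p v w * ln (p2 w) - p v w * ln (p v w))
      \<le> (\<Sum>v\<in>A. \<Sum>w\<in>B. p1 v * p2 w - p v w)"
    by (intro sum_mono pt)
  also have "\<dots> = (\<Sum>v\<in>A. p1 v) * (\<Sum>w\<in>B. p2 w) - 1"
    by (simp add: sum_subtractf s sum_product)
  also have "\<dots> = 0" using s1 s2 by simp
  also have "(\<Sum>v\<in>A. \<Sum>w\<in>B. p v w * ln (p1 v) + p v w * ln (p2 w) - p v w * ln (p v w))
     = (\<Sum>v\<in>A. \<Sum>w\<in>B. p v w * ln (p1 v)) + (\<Sum>v\<in>A. \<Sum>w\<in>B. p v w * ln (p2 w)) - (\<Sum>v\<in>A. \<Sum>w\<in>B. p v w * ln (p v w))"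
    by (simp add: sum_subtractf sum.distrib)
  also have "(\<Sum>v\<in>A. \<Sum>w\<in>B. p v w * ln (p1 v)) = (\<Sum>v\<in>A. p1 v * ln (p1 v))"
    by (intro sum.cong refl) (simp add: p1 flip: sum_distrib_right)
  also have "(\<Sum>v\<in>A. \<Sum>w\<in>B. p v w * ln (p2 w)) = (\<Sum>w\<in>B. p2 w * ln (p2 w))"
    by (subst sum.swap, intro sum.cong refl) (simp add: p2 flip: sum_distrib_right)
  finally show ?thesis by simp
qed

section \<open>Cylinder probabilities and block entropy\<close>

text \<open>A finite partition given by its labels: words then index the cylinders, empty or not,
  and entropies become sums over words.\<close>

locale labelled_system = prob_space M for M :: "'a measure" +
  fixes T :: "'a \<Rightarrow> 'a" and a :: "'a \<Rightarrow> nat" and N :: nat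
  assumes T_meas [measurable]: "T \<in> measurable M M" and T_inv: "distr M M T = M"
    and a_meas [measurable]: "a \<in> measurable M (count_space UNIV)" and a_less: "\<And>x. x \<in> space M \<Longrightarrow> a x < N"
begin

lemma iter_meas [measurable]: "T ^^ n \<in> measurable M M"
proof (induction n)
  case (Suc n)
  then show ?case using T_meas by (simp add: measurable_comp)
qed (simp add: id_def)

lemma iter_space: "x \<in> space M \<Longrightarrow> (T ^^ n) x \<in> space M"
  using measurable_space[OF iter_meas] .

lemma iter_inv: "distr M M (T ^^ n) = M"
proof (induction n)
  case (Suc n)
  have "distr M M (T \<circ> (T ^^ n)) = distr (distr M M (T ^^ n)) M T"
    by (rule distr_distr[symmetric]) measurable
  then show ?case by (simp add: Suc T_inv o_def)
qed (simp add: id_def distr_id)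

lemma prob_iter: "A \<in> sets M \<Longrightarrow> prob {x \<in> space M. (T ^^ n) x \<in> A} = prob A"
  using measure_distr[OF iter_meas, of A n] by (simp add: iter_inv vimage_def Int_def conj_commute)

definition block :: "nat \<Rightarrow> 'a \<Rightarrow> nat list" where
  "block n x = map (\<lambda>i. a ((T ^^ i) x)) [0..<n]"

definition cyl :: "nat list \<Rightarrow> 'a set" where
  "cyl w = {x \<in> space M. block (length w) x = w}"

lemma length_block [simp]: "length (block n x) = n"
  by (simp add: block_def)

lemma block_in_words: "x \<in> space M \<Longrightarrow> block n x \<in> words N n"
  unfolding block_def by (intro map_upt_in_words a_less iter_space)

lemma block_add: "block (m + n) x = block m x @ block n ((T ^^ m) x)"
proof (rule nth_equalityI)
  fix i assume i: "i < length (block (m + n) x)"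
  have "(T ^^ i) x = (T ^^ (i - m)) ((T ^^ m) x)" if "m \<le> i"
    using that funpow_add[of "i - m" m T] by simp
  then show "block (m + n) x ! i = (block m x @ block n ((T ^^ m) x)) ! i"
    using i by (auto simp: block_def nth_append)
qed (simp add: block_def)

lemma cyl_meas [measurable]: "cyl w \<in> sets M"
proof -
  have "block (length w) x = w \<longleftrightarrow> (\<forall>i\<in>{..<length w}. a ((T ^^ i) x) = w ! i)" for x
    unfolding list_eq_iff_nth_eq by (auto simp: block_def)
  then have "cyl w = {x \<in> space M. \<forall>i\<in>{..<length w}. a ((T ^^ i) x) = w ! i}"
    by (simp add: cyl_def)
  also have "\<dots> \<in> sets M"
  proof (rule sets.sets_Collect_finite_All)
    fix i
    have "{x \<in> space M. a ((T ^^ i) x) = w ! i} = (\<lambda>x. a ((T ^^ i) x)) -` {w ! i} \<inter> space M" by auto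
    also have "\<dots> \<in> sets M"
      using measurable_compose[OF iter_meas a_meas, of i] by (rule measurable_sets) simp
    finally show "{x \<in> space M. a ((T ^^ i) x) = w ! i} \<in> sets M" .
  qed simp
  finally show ?thesis .
qed

lemma cyl_append: "cyl (v @ w) = cyl v \<inter> {x \<in> space M. (T ^^ length v) x \<in> cyl w}"
  by (auto simp: cyl_def block_add iter_space)

lemma sum_prob_Int_cyl:
  assumes [measurable]: "A \<in> sets M"
  shows "(\<Sum>w\<in>words N n. prob (A \<inter> cyl w)) = prob A"
proof -
  have "A = (\<Union>w\<in>words N n. A \<inter> cyl w)"
    using sets.sets_into_space[OF assms] block_in_words by (auto simp: cyl_def words_def)
  moreover have "prob (\<Union>w\<in>words N n. A \<inter> cyl w) = (\<Sum>w\<in>words N n. prob (A \<inter> cyl w))"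
  proof (rule finite_measure_finite_Union)
    show "disjoint_family_on (\<lambda>w. A \<inter> cyl w) (words N n)"
      by (auto simp: disjoint_family_on_def cyl_def words_def)
  qed auto
  ultimately show ?thesis by simp
qed

lemma sum_prob_cyl: "(\<Sum>w\<in>words N n. prob (cyl w)) = 1"
  using sum_prob_Int_cyl[OF sets.top, of n] by (simp add: prob_space Int_absorb1 cyl_def)

lemma sum_prob_append_right: "(\<Sum>w\<in>words N n. prob (cyl (v @ w))) = prob (cyl v)"
proof -
  have "{x \<in> space M. (T ^^ m) x \<in> cyl w} \<inter> {x \<in> space M. (T ^^ m) x \<in> cyl w'} = {}"
    if "w \<in> words N n" "w' \<in> words N n" "w \<noteq> w'" for m w w'
    using that by (auto simp: cyl_def words_def)
  then have "prob (\<Union>w\<in>words N n. cyl (v @ w)) = (\<Sum>w\<in>words N n. prob (cyl (v @ w)))"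
    by (intro finite_measure_finite_Union) (auto simp: disjoint_family_on_def cyl_append)
  moreover have "cyl v = (\<Union>w\<in>words N n. cyl (v @ w))"
  proof (intro equalityI subsetI)
    fix x assume x: "x \<in> cyl v"
    define w where "w = block n ((T ^^ length v) x)"
    have "(T ^^ length v) x \<in> space M" using x iter_space by (simp add: cyl_def)
    then have "w \<in> words N n" "(T ^^ length v) x \<in> cyl w"
      using block_in_words by (simp_all add: w_def cyl_def)
    then show "x \<in> (\<Union>w\<in>words N n. cyl (v @ w))"
      using x by (auto simp: cyl_append) (auto simp: cyl_def)
  qed (auto simp: cyl_append)
  ultimately show ?thesis by simp
qed

text \<open>Forgetting the first \<open>m\<close> letters replaces the cylinder by its preimage
  under \<open>T ^^ m\<close>; invariance enters here.\<close>

lemma sum_prob_append_left: "(\<Sum>v\<in>words N m. prob (cyl (v @ w))) = prob (cyl w)"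
proof -
  have "(\<Sum>v\<in>words N m. prob (cyl (v @ w))) = (\<Sum>v\<in>words N m. prob ({x \<in> space M. (T ^^ m) x \<in> cyl w} \<inter> cyl v))"
    by (intro sum.cong refl) (auto simp: cyl_append words_def Int_commute)
  also have "\<dots> = prob {x \<in> space M. (T ^^ m) x \<in> cyl w}"
    by (rule sum_prob_Int_cyl) measurable
  also have "\<dots> = prob (cyl w)" by (rule prob_iter) measurable
  finally show ?thesis .
qed

definition block_entropy :: "nat \<Rightarrow> real" where
  "block_entropy n = - (\<Sum>w\<in>words N n. prob (cyl w) * ln (prob (cyl w)))"

lemma block_entropy_nonneg: "0 \<le> block_entropy n"
  unfolding block_entropy_def sum_negf[symmetric]
proof (rule sum_nonneg)
  fix w show "0 \<le> - (prob (cyl w) * ln (prob (cyl w)))"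
    by (cases "prob (cyl w) = 0") (auto simp: mult_le_0_iff zero_less_measure_iff)
qed

lemma block_entropy_add: "block_entropy (m + n) \<le> block_entropy m + block_entropy n"
  using entropy_subadditive[of "words N m" "words N n" "\<lambda>v w. prob (cyl (v @ w))" "\<lambda>v. prob (cyl v)" "\<lambda>w. prob (cyl w)"]
  unfolding block_entropy_def sum_words_add
  by (simp add: sum_prob_append_left sum_prob_append_right sum_prob_cyl)

definition fibres :: "'a set set" where
  "fibres = (\<lambda>i. {x \<in> space M. a x = i}) ` {..<N}"

lemma fibres_partition: "finite_meas_partition M fibres"
  unfolding finite_meas_partition_def fibres_def
  by (auto simp: disjoint_def a_less)

lemma iter_join_fibres: "iter_join M T fibres n = cyl ` words N n"
proof -
  have eq: "(\<Inter>i<n. (T ^^ i) -` {x \<in> space M. a x = w ! i}) \<inter> space M = cyl w" if "length w = n" for w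
  proof -
    have "block n x = w \<longleftrightarrow> (\<forall>i<n. a ((T ^^ i) x) = w ! i)" for x
      unfolding list_eq_iff_nth_eq using that by (simp add: block_def)
    then show ?thesis using that iter_space by (auto simp: cyl_def)
  qed
  show ?thesis
  proof (intro equalityI subsetI)
    fix B assume "B \<in> iter_join M T fibres n"
    then obtain f where f: "f \<in> {..<n} \<rightarrow>\<^sub>E fibres" "B = (\<Inter>i<n. (T ^^ i) -` f i) \<inter> space M"
      unfolding iter_join_def by auto
    have "\<forall>i\<in>{..<n}. \<exists>k<N. f i = {x \<in> space M. a x = k}"
      using f(1) by (auto simp: fibres_def PiE_iff)
    then obtain g where g: "\<And>i. i < n \<Longrightarrow> g i < N" "\<And>i. i < n \<Longrightarrow> f i = {x \<in> space M. a x = g i}"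
      by (metis lessThan_iff)
    define w where "w = map g [0..<n]"
    have "w \<in> words N n" unfolding w_def using g(1) by (rule map_upt_in_words)
    moreover have "B = (\<Inter>i<n. (T ^^ i) -` {x \<in> space M. a x = w ! i}) \<inter> space M"
      unfolding f(2) using g(2) by (auto simp: w_def)
    ultimately show "B \<in> cyl ` words N n" using eq by (auto simp: words_def)
  next
    fix B assume "B \<in> cyl ` words N n"
    then obtain w where w: "w \<in> words N n" "B = cyl w" by auto
    define f where "f = (\<lambda>i\<in>{..<n}. {x \<in> space M. a x = w ! i})"
    have "w ! i < N" if "i < n" for i using w(1) that by (auto simp: words_def subset_iff)
    then have "f \<in> {..<n} \<rightarrow>\<^sub>E fibres" by (auto simp: f_def fibres_def)
    moreover have "B = (\<Inter>i<n. (T ^^ i) -` f i) \<inter> space M"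
      using eq[of w] w by (simp add: f_def words_def)
    ultimately show "B \<in> iter_join M T fibres n" unfolding iter_join_def by auto
  qed
qed

text \<open>\<open>iter_join\<close> is a set and merges words with equal cylinders. Distinct words
  of the same length share a cylinder only if it is empty, and then the summand is 0.\<close>

lemma part_entropy_iter_join: "part_entropy M (iter_join M T fibres n) = block_entropy n"
proof -
  have "(\<Sum>A\<in>cyl ` words N n. prob A * ln (prob A)) = (\<Sum>w\<in>words N n. prob (cyl w) * ln (prob (cyl w)))"
  proof (subst sum.reindex_nontrivial)
    fix v w assume "v \<in> words N n" "w \<in> words N n" "v \<noteq> w" "cyl v = cyl w"
    then have "cyl v = {}" by (auto simp: cyl_def words_def)
    then show "prob (cyl v) * ln (prob (cyl v)) = 0" by simp
  qed auto
  then show ?thesis by (simp add: part_entropy_def block_entropy_def iter_join_fibres)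
qed

text \<open>\<open>fibres\<close> competes in the supremum defining \<open>ks_entropy\<close>, so
  its block entropy per letter has a limit below \<open>\<kappa>\<close>.\<close>

lemma ex_block_entropy_less:
  assumes "ks_entropy M T < ereal \<kappa>"
  shows "\<exists>m\<ge>1. block_entropy m < real m * \<kappa>"
proof -
  have conv: "convergent (\<lambda>n. block_entropy n / real n)"
    using block_entropy_nonneg block_entropy_add by (rule convergent_subadditive)
  have "ereal (ks_entropy_part M T fibres) \<le> ks_entropy M T"
    unfolding ks_entropy_def using fibres_partition by (intro SUP_upper) auto
  then have "ks_entropy_part M T fibres < \<kappa>"
    using assms by (metis ereal_less_eq(3) le_less_trans less_ereal.simps(1))
  then have "lim (\<lambda>n. block_entropy n / real n) < \<kappa>"
    by (simp add: ks_entropy_part_def part_entropy_iter_join)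
  then have "\<forall>\<^sub>F n in sequentially. block_entropy n / real n < \<kappa>"
    using conv[unfolded convergent_LIMSEQ_iff] by (rule order_tendstoD(2)[rotated])
  then obtain n0 where "\<And>n. n \<ge> n0 \<Longrightarrow> block_entropy n / real n < \<kappa>"
    by (auto simp: eventually_sequentially)
  then have "block_entropy (Suc n0) / real (Suc n0) < \<kappa>" using le_SucI by blast
  then have "block_entropy (Suc n0) < real (Suc n0) * \<kappa>" by (simp add: field_simps)
  then show ?thesis by (intro exI[of _ "Suc n0"]) simp
qed

text \<open>Rational weights leave only countably many code lengths.\<close>

lemma ex_rational_code:
  assumes "ks_entropy M T < ereal \<kappa>"
  shows "\<exists>m\<ge>1. \<exists>Q\<in>words N m \<rightarrow>\<^sub>E \<rat>. (\<forall>w\<in>words N m. 0 < Q w) \<and> (\<Sum>w\<in>words N m. Q w) \<le> 1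
    \<and> (\<Sum>w\<in>words N m. prob (cyl w) * - ln (Q w)) < real m * \<kappa>"
proof -
  obtain m where m: "m \<ge> 1" "block_entropy m < real m * \<kappa>"
    using ex_block_entropy_less[OF assms] by blast
  define g where "g = (real m * \<kappa> - block_entropy m) / 2"
  \<comment> \<open>Shrinking all probabilities by \<open>\<theta>\<close> lengthens the codes by
    \<open>g\<close>, half of the gap, and frees the mass \<open>1 - \<theta>\<close>. Each of the
    \<open>K\<close> words takes less than \<open>(1 - \<theta>) / real K\<close> of it, which pays
    for rounding up to a rational and for positive weights on words of probability 0.\<close>
  define \<theta> where "\<theta> = exp (- g)"
  define K where "K = card (words N m)"
  have g: "g > 0" using m by (simp add: g_def)
  then have \<theta>: "0 < \<theta>" "\<theta> < 1" by (auto simp: \<theta>_def)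
  obtain x where "x \<in> space M" using not_empty by blast
  then have K: "K > 0" unfolding K_def using block_in_words by (auto simp: card_gt_0_iff)
  have "\<exists>q\<in>\<rat>. \<theta> * prob (cyl w) < q \<and> q < \<theta> * prob (cyl w) + (1 - \<theta>) / real K" for w
    using \<theta> K Rats_dense_in_real[of "\<theta> * prob (cyl w)" "\<theta> * prob (cyl w) + (1 - \<theta>) / real K"] by auto
  then obtain q where q: "\<And>w. q w \<in> \<rat>" "\<And>w. \<theta> * prob (cyl w) < q w" "\<And>w. q w < \<theta> * prob (cyl w) + (1 - \<theta>) / real K"
    by metis
  define Q where "Q = (\<lambda>w\<in>words N m. q w)"
  have Q: "Q w = q w" if "w \<in> words N m" for w using that by (simp add: Q_def)
  have qpos: "0 < q w" for w using q(2)[of w] \<theta> by (meson le_less_trans measure_nonneg mult_nonneg_nonneg less_imp_le)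
  have "(\<Sum>w\<in>words N m. Q w) \<le> (\<Sum>w\<in>words N m. \<theta> * prob (cyl w) + (1 - \<theta>) / real K)"
    using q(3) Q by (intro sum_mono) (auto intro: less_imp_le)
  also have "\<dots> = \<theta> * (\<Sum>w\<in>words N m. prob (cyl w)) + real K * ((1 - \<theta>) / real K)"
    by (simp add: sum.distrib sum_distrib_left K_def)
  also have "\<dots> = 1" using K by (simp add: sum_prob_cyl)
  finally have sQ: "(\<Sum>w\<in>words N m. Q w) \<le> 1" .
  have "(\<Sum>w\<in>words N m. prob (cyl w) * - ln (Q w))
      \<le> (\<Sum>w\<in>words N m. - (prob (cyl w) * ln (prob (cyl w))) + prob (cyl w) * g)"
  proof (rule sum_mono)
    fix w assume w: "w \<in> words N m"
    show "prob (cyl w) * - ln (Q w) \<le> - (prob (cyl w) * ln (prob (cyl w))) + prob (cyl w) * g"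
    proof (cases "prob (cyl w) = 0")
      case False
      then have pos: "prob (cyl w) > 0" by (simp add: zero_less_measure_iff)
      have "ln (\<theta> * prob (cyl w)) \<le> ln (q w)"
        using q(2)[of w] \<theta> pos qpos[of w] by (subst ln_le_cancel_iff) auto
      then have "- ln (Q w) \<le> g - ln (prob (cyl w))"
        using pos \<theta> Q[OF w] by (simp add: ln_mult \<theta>_def)
      then have "prob (cyl w) * - ln (Q w) \<le> prob (cyl w) * (g - ln (prob (cyl w)))"
        using pos by (intro mult_left_mono) auto
      then show ?thesis by (simp add: algebra_simps)
    qed simp
  qed
  also have "\<dots> = block_entropy m + g"
    using sum_prob_cyl[of m] by (simp add: sum.distrib block_entropy_def sum_negf sum_subtractf flip: sum_distrib_right)
  also have "\<dots> < real m * \<kappa>"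
  proof -
    have "b + (c - b) / 2 < c" if "b < c" for b c :: real using that by (simp add: field_simps)
    from this[OF m(2)] show ?thesis by (simp add: g_def)
  qed
  finally show ?thesis
    using m(1) sQ Q q(1) qpos by (intro exI[of _ m] conjI bexI[of _ Q]) (auto simp: Q_def)
qed

end

section \<open>Averages over powers\<close>

text \<open>Heine--Cantor on the power. Its points are \<open>undefined\<close> from coordinate
  \<open>r\<close> on; giving those coordinates the range \<open>{undefined}\<close> exhibits the
  power as a compact set in the metric space of all functions on \<open>nat\<close>.\<close>

lemma continuous_product_uniform:
  fixes X :: "'a::metric_space set" and g :: "(nat \<Rightarrow> 'a) \<Rightarrow> real"
  assumes X: "compact X"
    and g: "continuous_map (product_topology (\<lambda>_. top_of_set X) {..<r}) euclideanreal g"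
  shows "bounded (g ` ({..<r} \<rightarrow>\<^sub>E X))"
    and "e > 0 \<Longrightarrow> \<exists>d>0. \<forall>z\<in>{..<r} \<rightarrow>\<^sub>E X. \<forall>z'\<in>{..<r} \<rightarrow>\<^sub>E X. (\<forall>j<r. dist (z j) (z' j) < d) \<longrightarrow> \<bar>g z - g z'\<bar> < e"
proof -
  let ?S = "{..<r} \<rightarrow>\<^sub>E X"
  have mem: "z \<in> ?S \<longleftrightarrow> (\<forall>i. z i \<in> (if i < r then X else {undefined}))" for z
    by (auto simp: PiE_iff extensional_def Ball_def)
  have S: "?S = (\<Pi>\<^sub>E i\<in>UNIV. if i < r then X else {undefined})"
    by (rule set_eqI, subst mem) (simp add: PiE_iff)
  have "compactin (product_topology (\<lambda>i. euclidean) UNIV) ?S"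
    unfolding S compactin_PiE using X by (auto simp: compactin_euclidean_iff)
  then have cS: "compact ?S"
    by (simp add: euclidean_product_topology compactin_euclidean_iff)
  have "continuous_map (top_of_set ?S) (product_topology (\<lambda>_. top_of_set X) {..<r}) (\<lambda>z. z)"
    unfolding continuous_map_componentwise
  proof (intro conjI ballI)
    fix k assume k: "k \<in> {..<r}"
    have "continuous_on ?S (\<lambda>z. z k)"
      using continuous_on_product_coordinates by (rule continuous_on_subset) simp
    then show "continuous_map (top_of_set ?S) (top_of_set X) (\<lambda>z. z k)"
      using k by (auto simp: continuous_map_in_subtopology)
  qed (auto simp: PiE_def)
  from continuous_map_compose[OF this g]
  have cg: "continuous_on ?S g" by (simp add: o_def)
  show "bounded (g ` ?S)"
    using cg cS by (intro compact_imp_bounded compact_continuous_image)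
  assume "e > 0"
  then obtain d where d: "d > 0" "\<And>z z'. z \<in> ?S \<Longrightarrow> z' \<in> ?S \<Longrightarrow> dist z' z < d \<Longrightarrow> dist (g z') (g z) < e"
    using compact_uniformly_continuous[OF cg cS] unfolding uniformly_continuous_on_def by metis
  \<comment> \<open>The metric is at most twice a maximum of finitely many coordinate distances plus
    \<open>(1/2) ^ N\<close>; with \<open>d / 4\<close> per coordinate the bound tends to
    \<open>d / 2 < d\<close>.\<close>
  have "\<bar>g z - g z'\<bar> < e" if z: "z \<in> ?S" "z' \<in> ?S" and close: "\<forall>j<r. dist (z j) (z' j) < d / 4" for z z'
  proof -
    have dj: "dist (z j) (z' j) \<le> d / 4" for j
    proof (cases "j < r")
      case False
      then have "z j = z' j" using z by (auto simp: PiE_iff extensional_def)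
      then show ?thesis using d(1) by simp
    qed (use close in \<open>auto intro: less_imp_le\<close>)
    have "dist z z' \<le> d / 2 + (1/2) ^ N" for N
    proof -
      have "dist z z' \<le> 2 * Max {dist (z (from_nat n)) (z' (from_nat n)) |n. n \<le> N} + (1/2)^N"
        by (rule dist_fun_le_dist_first_terms)
      also have "Max {dist (z (from_nat n)) (z' (from_nat n)) |n. n \<le> N} \<le> d / 4"
        using dj by (intro Max.boundedI) auto
      finally show ?thesis by simp
    qed
    moreover have "(\<lambda>N. d / 2 + (1/2::real) ^ N) \<longlonglongrightarrow> d / 2 + 0"
      by (intro tendsto_intros LIMSEQ_power_zero) simp
    ultimately have "dist z z' \<le> d / 2" using LIMSEQ_le_const[of "\<lambda>N. d / 2 + (1/2) ^ N" "d / 2" "dist z z'"] by simp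
    then show ?thesis using d(1) d(2)[of z' z] z by (simp add: dist_real_def)
  qed
  then show "\<exists>d>0. \<forall>z\<in>?S. \<forall>z'\<in>?S. (\<forall>j<r. dist (z j) (z' j) < d) \<longrightarrow> \<bar>g z - g z'\<bar> < e"
    using d(1) by (intro exI[of _ "d / 4"]) auto
qed

lemma ex_partition_of_unity:
  fixes X :: "'a::metric_space set"
  assumes X: "compact X" and d: "d > 0"
  obtains F and p :: "'a \<Rightarrow> 'a \<Rightarrow> real"
  where "finite F" "F \<subseteq> X" "\<And>c. c \<in> F \<Longrightarrow> continuous_on X (p c)" "\<And>c y. 0 \<le> p c y"
    "\<And>y. y \<in> X \<Longrightarrow> (\<Sum>c\<in>F. p c y) = 1" "\<And>c y. p c y \<noteq> 0 \<Longrightarrow> dist y c < d"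
proof -
  have "X \<subseteq> (\<Union>c\<in>X. ball c d)" using d by force
  then obtain F where F: "F \<subseteq> X" "finite F" "X \<subseteq> (\<Union>c\<in>F. ball c d)"
    using compactE_image[OF X, of X "\<lambda>c. ball c d"] by auto
  \<comment> \<open>A tent, positive exactly on the open ball of radius \<open>d\<close> around
    \<open>c\<close>; the balls cover \<open>X\<close>, so the normalising sum is positive
    there.\<close>
  define h where "h c y = max 0 (d - dist y c)" for c y :: 'a
  define p where "p c y = h c y / (\<Sum>b\<in>F. h b y)" for c y :: 'a
  have hn: "0 \<le> h c y" for c y by (simp add: h_def)
  have pos: "(\<Sum>b\<in>F. h b y) > 0" if "y \<in> X" for y
  proof -
    obtain c where c: "c \<in> F" "y \<in> ball c d" using \<open>y \<in> X\<close> F(3) by blast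
    then have "0 < h c y" by (simp add: h_def dist_commute)
    also have "h c y \<le> (\<Sum>b\<in>F. h b y)" using c(1) F(2) hn by (intro member_le_sum) auto
    finally show ?thesis .
  qed
  show thesis
  proof (rule that[of F p])
    show "continuous_on X (p c)" for c
      unfolding p_def h_def
      by (intro continuous_intros ballI) (use pos in \<open>force simp: h_def\<close>)
    show "0 \<le> p c y" for c y unfolding p_def by (intro divide_nonneg_nonneg sum_nonneg hn)
    show "(\<Sum>c\<in>F. p c y) = 1" if "y \<in> X" for y
      using pos[OF that] by (simp add: p_def flip: sum_divide_distrib)
    show "dist y c < d" if "p c y \<noteq> 0" for c y
    proof (rule ccontr)
      assume "\<not> dist y c < d"
      then have "h c y = 0" by (simp add: h_def)
      then show False using that by (simp add: p_def)
    qed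
  qed (fact F)+
qed

text \<open>Instead of Stone--Weierstrass: a partition of unity on the factor turns uniform continuity on the
  power into approximation by sums of products.\<close>

lemma ex_product_approximation:
  fixes X :: "'a::metric_space set" and g :: "(nat \<Rightarrow> 'a) \<Rightarrow> real"
  assumes X: "compact X" and e: "e > 0"
    and g: "continuous_map (product_topology (\<lambda>_. top_of_set X) {..<r}) euclideanreal g"
  obtains F and p :: "'a \<Rightarrow> 'a \<Rightarrow> real"
  where "finite F" "\<And>c. c \<in> F \<Longrightarrow> continuous_on X (p c)"
    "\<And>z. z \<in> {..<r} \<rightarrow>\<^sub>E X \<Longrightarrow> \<bar>g z - (\<Sum>w\<in>{..<r} \<rightarrow>\<^sub>E F. g w * (\<Prod>j<r. p (w j) (z j)))\<bar> \<le> e"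
proof -
  let ?S = "{..<r} \<rightarrow>\<^sub>E X"
  obtain d where d: "d > 0" "\<And>z z'. z \<in> ?S \<Longrightarrow> z' \<in> ?S \<Longrightarrow> (\<forall>j<r. dist (z j) (z' j) < d) \<Longrightarrow> \<bar>g z - g z'\<bar> < e"
    using continuous_product_uniform(2)[OF X g e] by blast
  obtain F and p :: "'a \<Rightarrow> 'a \<Rightarrow> real" where F: "finite F" "F \<subseteq> X" and p: "\<And>c. c \<in> F \<Longrightarrow> continuous_on X (p c)" "\<And>c y. 0 \<le> p c y"
    "\<And>y. y \<in> X \<Longrightarrow> (\<Sum>c\<in>F. p c y) = 1" "\<And>c y. p c y \<noteq> 0 \<Longrightarrow> dist y c < d"
    by (rule ex_partition_of_unity[OF X d(1)]) (rule that)
  have "\<bar>g z - (\<Sum>w\<in>{..<r} \<rightarrow>\<^sub>E F. g w * (\<Prod>j<r. p (w j) (z j)))\<bar> \<le> e" if z: "z \<in> ?S" for z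
  proof -
    define P where "P w = (\<Prod>j<r. p (w j) (z j))" for w
    have Pn: "0 \<le> P w" for w unfolding P_def by (intro prod_nonneg ballI p)
    \<comment> \<open>Multiplying out \<open>r\<close> partitions of unity gives one on the power,
      indexed by tuples of centres.\<close>
    have "(\<Sum>w\<in>{..<r} \<rightarrow>\<^sub>E F. P w) = (\<Prod>j<r. \<Sum>c\<in>F. p c (z j))"
      unfolding P_def using F by (subst prod_sum_PiE) auto
    also have "\<dots> = 1" using z by (intro prod.neutral ballI p) auto
    finally have sP: "(\<Sum>w\<in>{..<r} \<rightarrow>\<^sub>E F. P w) = 1" .
    have "g z - (\<Sum>w\<in>{..<r} \<rightarrow>\<^sub>E F. g w * P w) = (\<Sum>w\<in>{..<r} \<rightarrow>\<^sub>E F. (g z - g w) * P w)"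
      by (simp add: left_diff_distrib sum_subtractf sP flip: sum_distrib_left)
    also have "\<bar>\<dots>\<bar> \<le> (\<Sum>w\<in>{..<r} \<rightarrow>\<^sub>E F. \<bar>(g z - g w) * P w\<bar>)" by (rule sum_abs)
    also have "\<dots> \<le> (\<Sum>w\<in>{..<r} \<rightarrow>\<^sub>E F. e * P w)"
    proof (rule sum_mono)
      fix w assume w: "w \<in> {..<r} \<rightarrow>\<^sub>E F"
      show "\<bar>(g z - g w) * P w\<bar> \<le> e * P w"
      proof (cases "P w = 0")
        case False
        then have "\<forall>j<r. dist (z j) (w j) < d" using p(4) by (auto simp: P_def)
        moreover have "w \<in> ?S" using w F(2) by (auto simp: PiE_iff)
        ultimately have "\<bar>g z - g w\<bar> \<le> e" using d(2)[OF z] by (auto intro: less_imp_le)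
        then show ?thesis using Pn[of w] by (simp add: abs_mult mult_right_mono)
      qed simp
    qed
    also have "\<dots> = e" by (simp add: sP flip: sum_distrib_left)
    finally show ?thesis unfolding P_def .
  qed
  with F(1) p(1) show thesis by (rule that)
qed

text \<open>For a product of functions of one coordinate, the average over \<open>r\<close>-tuples
  is a product of \<open>r\<close> averages and the integral a product of integrals. Sums of such
  products approximate \<open>g\<close> uniformly.\<close>

lemma product_averages:
  fixes X :: "'a::metric_space set" and g :: "(nat \<Rightarrow> 'a) \<Rightarrow> real"
  assumes X: "compact X" and M: "prob_space M" "sets M = sets (restrict_space borel X)"
    and c: "\<And>i. c i \<in> X"
    and av: "\<And>f::'a \<Rightarrow> real. continuous_on X f \<Longrightarrow> (\<lambda>k. (\<Sum>i=1..\<sigma> k. f (c i)) / real (\<sigma> k)) \<longlonglongrightarrow> integral\<^sup>L M f"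
    and g: "continuous_map (product_topology (\<lambda>_. top_of_set X) {..<r}) euclideanreal g"
  shows "(\<lambda>k. (1 / real (\<sigma> k) ^ r) * (\<Sum>i\<in>{..<r} \<rightarrow>\<^sub>E {1..\<sigma> k}. g (\<lambda>j\<in>{..<r}. c (i j))))
     \<longlonglongrightarrow> (\<integral>z. g z \<partial>PiM {..<r} (\<lambda>_. M))"
proof -
  interpret M: prob_space M by fact
  interpret PM: product_sigma_finite "\<lambda>_::nat. M" by unfold_locales
  let ?P = "PiM {..<r} (\<lambda>_::nat. M)" and ?S = "{..<r} \<rightarrow>\<^sub>E X"
  interpret P: prob_space ?P by (intro prob_space_PiM M)
  have spP: "space ?P = ?S" using space_restrict_borel[OF M(2)] by (simp add: space_PiM)
  define A where "A h k = (1 / real (\<sigma> k) ^ r) * (\<Sum>i\<in>{..<r} \<rightarrow>\<^sub>E {1..\<sigma> k}. h (\<lambda>j\<in>{..<r}. c (i j)))" for h :: "(nat \<Rightarrow> 'a) \<Rightarrow> real" and k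
  have cont_meas: "f \<in> borel_measurable M" if "continuous_on X f" for f :: "'a \<Rightarrow> real"
    using borel_measurable_continuous_on_carrier[OF M(2) that] .
  have cont_int: "integrable M f" if f: "continuous_on X f" for f :: "'a \<Rightarrow> real"
  proof -
    obtain B where "\<And>x. x \<in> X \<Longrightarrow> \<bar>f x\<bar> \<le> B" using compact_continuous_bounded[OF X f] by metis
    then show ?thesis
      using space_restrict_borel[OF M(2)] cont_meas[OF f]
      by (intro M.integrable_const_bound[where B = B]) auto
  qed
  have prod_meas: "(\<lambda>z. \<Prod>j<r. f j (z j)) \<in> borel_measurable ?P" if "\<And>j. j < r \<Longrightarrow> continuous_on X (f j)" for f :: "nat \<Rightarrow> 'a \<Rightarrow> real"
    using that cont_meas
    by (intro borel_measurable_prod measurable_compose[OF measurable_component_singleton]) auto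
  have A_prod: "A (\<lambda>z. \<Prod>j<r. f j (z j)) \<longlonglongrightarrow> (\<integral>z. (\<Prod>j<r. f j (z j)) \<partial>?P)"
    if f: "\<And>j. j < r \<Longrightarrow> continuous_on X (f j)" for f :: "nat \<Rightarrow> 'a \<Rightarrow> real"
  proof -
    have "A (\<lambda>z. \<Prod>j<r. f j (z j)) k = (\<Prod>j<r. (\<Sum>i=1..\<sigma> k. f j (c i)) / real (\<sigma> k))" for k
    proof -
      have "(\<Prod>j<r. \<Sum>i\<in>{1..\<sigma> k}. f j (c i)) = (\<Sum>i\<in>{..<r} \<rightarrow>\<^sub>E {1..\<sigma> k}. \<Prod>j<r. f j (c (i j)))"
        by (rule prod_sum_PiE) auto
      then show ?thesis by (simp add: A_def prod_dividef)
    qed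
    then have "A (\<lambda>z. \<Prod>j<r. f j (z j)) = (\<lambda>k. \<Prod>j<r. (\<Sum>i=1..\<sigma> k. f j (c i)) / real (\<sigma> k))" by blast
    moreover have "(\<lambda>k. \<Prod>j<r. (\<Sum>i=1..\<sigma> k. f j (c i)) / real (\<sigma> k)) \<longlonglongrightarrow> (\<Prod>j<r. integral\<^sup>L M (f j))"
      using f by (intro tendsto_prod av) auto
    moreover have "(\<integral>z. (\<Prod>j<r. f j (z j)) \<partial>?P) = (\<Prod>j<r. integral\<^sup>L M (f j))"
      using f cont_int by (intro PM.product_integral_prod) auto
    ultimately show ?thesis by simp
  qed
  have prod_int: "integrable ?P (\<lambda>z. \<Prod>j<r. f j (z j))" if "\<And>j. j < r \<Longrightarrow> continuous_on X (f j)" for f :: "nat \<Rightarrow> 'a \<Rightarrow> real"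
    using that cont_int by (intro PM.product_integrable_prod) auto
  have A_diff: "\<bar>A g k - A h k\<bar> \<le> e" if "\<And>z. z \<in> ?S \<Longrightarrow> \<bar>g z - h z\<bar> \<le> e" "e \<ge> 0" for h e k
  proof -
    let ?I = "{..<r} \<rightarrow>\<^sub>E {1..\<sigma> k}"
    have "\<bar>\<Sum>i\<in>?I. g (\<lambda>j\<in>{..<r}. c (i j)) - h (\<lambda>j\<in>{..<r}. c (i j))\<bar> \<le> (\<Sum>i\<in>?I. e)"
      using c that(1) by (intro order_trans[OF sum_abs] sum_mono) auto
    also have "\<dots> = e * real (\<sigma> k) ^ r" by (simp add: card_PiE)
    finally have "(1 / real (\<sigma> k) ^ r) * \<bar>\<Sum>i\<in>?I. g (\<lambda>j\<in>{..<r}. c (i j)) - h (\<lambda>j\<in>{..<r}. c (i j))\<bar>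
        \<le> (1 / real (\<sigma> k) ^ r) * (e * real (\<sigma> k) ^ r)" by (rule mult_left_mono) simp
    \<comment> \<open>Equality can fail only for \<open>\<sigma> k = 0\<close>, where division by
      zero yields 0; hence the condition \<open>e \<ge> 0\<close>.\<close>
    also have "\<dots> \<le> e" using that(2) by simp
    finally have "(1 / real (\<sigma> k) ^ r) * \<bar>\<Sum>i\<in>?I. g (\<lambda>j\<in>{..<r}. c (i j)) - h (\<lambda>j\<in>{..<r}. c (i j))\<bar> \<le> e" .
    moreover have "A g k - A h k = (1 / real (\<sigma> k) ^ r) * (\<Sum>i\<in>?I. g (\<lambda>j\<in>{..<r}. c (i j)) - h (\<lambda>j\<in>{..<r}. c (i j)))"
      by (simp add: A_def sum_subtractf diff_divide_distrib)
    ultimately show ?thesis by (simp add: abs_mult)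
  qed
  have approx: "\<exists>h. h \<in> borel_measurable ?P \<and> integrable ?P h \<and> A h \<longlonglongrightarrow> integral\<^sup>L ?P h \<and> (\<forall>z\<in>?S. \<bar>g z - h z\<bar> \<le> e)"
    if "e > 0" for e
  proof -
    obtain F and p :: "'a \<Rightarrow> 'a \<Rightarrow> real" where F: "finite F" "\<And>c. c \<in> F \<Longrightarrow> continuous_on X (p c)"
      and le: "\<And>z. z \<in> {..<r} \<rightarrow>\<^sub>E X \<Longrightarrow> \<bar>g z - (\<Sum>w\<in>{..<r} \<rightarrow>\<^sub>E F. g w * (\<Prod>j<r. p (w j) (z j)))\<bar> \<le> e"
      by (rule ex_product_approximation[OF X \<open>e > 0\<close> g]) (rule that)
    define h where "h z = (\<Sum>w\<in>{..<r} \<rightarrow>\<^sub>E F. g w * (\<Prod>j<r. p (w j) (z j)))" for z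
    have pc: "continuous_on X (p (w j))" if "w \<in> {..<r} \<rightarrow>\<^sub>E F" "j < r" for w j
      using that by (intro F(2)) (auto simp: PiE_iff)
    have "h \<in> borel_measurable ?P"
      unfolding h_def by (intro borel_measurable_sum borel_measurable_times prod_meas pc) auto
    moreover have "integrable ?P h"
      unfolding h_def by (intro Bochner_Integration.integrable_sum integrable_mult_right prod_int pc)
    moreover have "A h \<longlonglongrightarrow> integral\<^sup>L ?P h"
    proof -
      have "A h = (\<lambda>k. \<Sum>w\<in>{..<r} \<rightarrow>\<^sub>E F. g w * A (\<lambda>z. \<Prod>j<r. p (w j) (z j)) k)"
      proof
        fix k
        have "(\<Sum>i\<in>{..<r} \<rightarrow>\<^sub>E {1..\<sigma> k}. h (\<lambda>j\<in>{..<r}. c (i j)))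
            = (\<Sum>w\<in>{..<r} \<rightarrow>\<^sub>E F. \<Sum>i\<in>{..<r} \<rightarrow>\<^sub>E {1..\<sigma> k}. g w * (\<Prod>j<r. p (w j) ((\<lambda>j\<in>{..<r}. c (i j)) j)))"
          unfolding h_def by (rule sum.swap)
        then show "A h k = (\<Sum>w\<in>{..<r} \<rightarrow>\<^sub>E F. g w * A (\<lambda>z. \<Prod>j<r. p (w j) (z j)) k)"
          unfolding A_def by (simp add: sum_distrib_left mult_ac)
      qed
      moreover have "(\<lambda>k. \<Sum>w\<in>{..<r} \<rightarrow>\<^sub>E F. g w * A (\<lambda>z. \<Prod>j<r. p (w j) (z j)) k)
          \<longlonglongrightarrow> (\<Sum>w\<in>{..<r} \<rightarrow>\<^sub>E F. g w * (\<integral>z. (\<Prod>j<r. p (w j) (z j)) \<partial>?P))"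
        by (intro tendsto_sum tendsto_mult tendsto_const A_prod pc)
      moreover have "integral\<^sup>L ?P h = (\<Sum>w\<in>{..<r} \<rightarrow>\<^sub>E F. g w * (\<integral>z. (\<Prod>j<r. p (w j) (z j)) \<partial>?P))"
        unfolding h_def
        by (subst Bochner_Integration.integral_sum) (auto intro!: integrable_mult_right prod_int pc)
      ultimately show ?thesis by simp
    qed
    ultimately show ?thesis using le unfolding h_def by blast
  qed
  \<comment> \<open>Measurability for the product sigma-algebra comes from uniform approximation,
    without comparing that algebra with the Borel sets of the power.\<close>
  have g_meas: "g \<in> borel_measurable ?P"
  proof -
    have "\<exists>h. \<forall>n. h n \<in> borel_measurable ?P \<and> (\<forall>z\<in>?S. \<bar>g z - h n z\<bar> \<le> inverse (real (Suc n)))"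
    proof (intro choice allI)
      fix n
      have "inverse (real (Suc n)) > 0" by simp
      from approx[OF this]
      show "\<exists>h. h \<in> borel_measurable ?P \<and> (\<forall>z\<in>?S. \<bar>g z - h z\<bar> \<le> inverse (real (Suc n)))" by blast
    qed
    then obtain h where h: "\<And>n. h n \<in> borel_measurable ?P" "\<And>n z. z \<in> ?S \<Longrightarrow> \<bar>g z - h n z\<bar> \<le> inverse (real (Suc n))"
      by blast
    show ?thesis
    proof (rule borel_measurable_LIMSEQ_real[OF _ h(1)])
      fix z assume "z \<in> space ?P"
      then have "norm (h n z - g z) \<le> inverse (real (Suc n))" for n
        using h(2)[of z n] unfolding spP by (simp add: abs_minus_commute)
      then have "(\<lambda>n. h n z - g z) \<longlonglongrightarrow> 0"
        by (intro Lim_null_comparison[OF _ LIMSEQ_inverse_real_of_nat]) simp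
      then show "(\<lambda>n. h n z) \<longlonglongrightarrow> g z" by (simp add: LIM_zero_iff)
    qed
  qed
  have g_int: "integrable ?P g"
  proof -
    obtain B where "\<And>z. z \<in> ?S \<Longrightarrow> \<bar>g z\<bar> \<le> B"
      using continuous_product_uniform(1)[OF X g] by (auto simp: bounded_iff)
    then show ?thesis
      using g_meas spP by (intro P.integrable_const_bound[where B = B]) auto
  qed
  have "A g \<longlonglongrightarrow> integral\<^sup>L ?P g"
  proof (rule LIMSEQ_I)
    fix e :: real assume "e > 0"
    then obtain h where h: "integrable ?P h" "A h \<longlonglongrightarrow> integral\<^sup>L ?P h" "\<And>z. z \<in> ?S \<Longrightarrow> \<bar>g z - h z\<bar> \<le> e / 4"
      using approx[of "e / 4"] by auto
    have "\<bar>integral\<^sup>L ?P g - integral\<^sup>L ?P h\<bar> = \<bar>\<integral>z. g z - h z \<partial>?P\<bar>"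
      using g_int h(1) by simp
    also have "\<dots> \<le> (\<integral>z. \<bar>g z - h z\<bar> \<partial>?P)" using integral_norm_bound[of ?P "\<lambda>z. g z - h z"] by simp
    also have "\<dots> \<le> (\<integral>z. e / 4 \<partial>?P)"
      using g_int h(1,3) spP by (intro integral_mono) auto
    also have "\<dots> = e / 4" by (simp add: P.prob_space)
    finally have I: "\<bar>integral\<^sup>L ?P g - integral\<^sup>L ?P h\<bar> \<le> e / 4" .
    obtain n0 where n0: "\<And>k. k \<ge> n0 \<Longrightarrow> norm (A h k - integral\<^sup>L ?P h) < e / 4"
      using LIMSEQ_D[OF h(2), of "e / 4"] \<open>e > 0\<close> by auto
    have "norm (A g k - integral\<^sup>L ?P g) < e" if "k \<ge> n0" for k
    proof -
      have "\<bar>A g k - A h k\<bar> \<le> e / 4" using \<open>e > 0\<close> h(3) by (intro A_diff) auto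
      then show ?thesis using n0[OF that] I \<open>e > 0\<close> unfolding real_norm_def by linarith
    qed
    then show "\<exists>n0. \<forall>k\<ge>n0. norm (A g k - integral\<^sup>L ?P g) < e" by blast
  qed
  then show ?thesis unfolding A_def .
qed

section \<open>Bowen's theorem and the main result\<close>

text \<open>The distribution of each distance has at most countably many atoms, while the interval
  of radii is uncountable.\<close>

lemma (in prob_space) ex_null_spheres:
  fixes c :: "nat \<Rightarrow> 'a" and D :: "'a \<Rightarrow> 'a \<Rightarrow> real"
  assumes D: "\<And>j. D (c j) \<in> borel_measurable M" and lh: "lo < hi"
  shows "\<exists>\<rho>. lo < \<rho> \<and> \<rho> < hi \<and> (\<forall>j<N::nat. prob {y \<in> space M. D (c j) y = \<rho>} = 0)"
proof -
  have "countable {\<rho>. measure (distr M borel (D (c j))) {\<rho>} \<noteq> 0}" for j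
  proof -
    interpret Dj: prob_space "distr M borel (D (c j))" using D by (rule prob_space_distr)
    show ?thesis by (rule Dj.countable_support)
  qed
  then have "countable (\<Union>j<N. {\<rho>. measure (distr M borel (D (c j))) {\<rho>} \<noteq> 0})" by auto
  moreover have "uncountable {lo<..<hi}" using lh by (simp add: uncountable_open_interval)
  ultimately have "\<not> {lo<..<hi} \<subseteq> (\<Union>j<N. {\<rho>. measure (distr M borel (D (c j))) {\<rho>} \<noteq> 0})"
    using countable_subset by blast
  then obtain \<rho> where "\<rho> \<in> {lo<..<hi}" "\<rho> \<notin> (\<Union>j<N. {\<rho>. measure (distr M borel (D (c j))) {\<rho>} \<noteq> 0})"
    by blast
  then have \<rho>: "lo < \<rho>" "\<rho> < hi" "\<And>j. j < N \<Longrightarrow> measure (distr M borel (D (c j))) {\<rho>} = 0"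
    by auto
  have "{y \<in> space M. D (c j) y = \<rho>} = D (c j) -` {\<rho>} \<inter> space M" for j by auto
  then show ?thesis using \<rho> D by (auto simp: measure_distr)
qed

context compact_system
begin

lemma Minv_D:
  assumes "M \<in> Minv X T"
  shows "prob_space M" "sets M = sets (restrict_space borel X)" "T \<in> measurable M M" "distr M M T = M" "space M = X"
  using assms space_restrict_borel by (auto simp: Minv_def)

text \<open>The weights encode the block statistics of the limit measure for a partition with null
  boundaries. Along \<open>\<sigma>\<close> each word occurs with at most slightly more than its
  probability, so the average code length stays below \<open>m * \<kappa>\<close>.\<close>

lemma frequently_low_cost:
  assumes M: "M \<in> Minv X T" and x: "x \<in> X" and \<sigma>: "strict_mono \<sigma>"
    and av: "averages_to X (\<lambda>j. (T ^^ j) x) \<sigma> M" and ks: "ks_entropy M T < ereal \<kappa>"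
    and eps: "eps > 0" and cover: "X \<subseteq> (\<Union>j<N. ball (c j) (eps / 4))"
  shows "\<exists>m\<ge>1. \<exists>Q\<in>words N m \<rightarrow>\<^sub>E \<rat>. (\<forall>w\<in>words N m. 0 < Q w) \<and> (\<Sum>w\<in>words N m. Q w) \<le> 1
    \<and> (\<exists>\<^sub>\<infinity>n. x \<in> low_cost_points T X c N eps m Q \<kappa> n)"
proof -
  note MD = Minv_D[OF M]
  interpret prob_space M by (rule MD(1))
  have dist_meas [measurable]: "dist (c j) \<in> borel_measurable M" for j
    using MD(2) by (rule borel_measurable_continuous_on_carrier) (intro continuous_intros)
  \<comment> \<open>Beyond \<open>eps / 4\<close> the balls still cover \<open>X\<close>; below
    \<open>eps / 2\<close> their labels are admissible in \<open>low_cost_points\<close>.\<close>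
  have "eps / 4 < eps / 2" using eps by simp
  then obtain \<rho> where \<rho>: "eps / 4 < \<rho>" "\<rho> < eps / 2" and null: "\<And>j. j < N \<Longrightarrow> prob {y \<in> space M. dist (c j) y = \<rho>} = 0"
    using ex_null_spheres[of dist c "eps / 4" "eps / 2" N] dist_meas by blast
  define a where "a y = (LEAST j. dist (c j) y < \<rho>)" for y
  have a: "dist (c (a y)) y < \<rho>" "a y < N" "\<And>j. j < a y \<Longrightarrow> \<rho> \<le> dist (c j) y" if "y \<in> X" for y
  proof -
    obtain j where j: "j < N" "dist (c j) y < \<rho>" using cover \<open>y \<in> X\<close> \<rho>(1) by fastforce
    show "dist (c (a y)) y < \<rho>" unfolding a_def using j(2) by (rule LeastI)
    have "a y \<le> j" unfolding a_def using j(2) by (rule Least_le)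
    then show "a y < N" using j(1) by simp
    show "\<rho> \<le> dist (c j) y" if "j < a y" for j
      using not_less_Least[OF that[unfolded a_def]] by simp
  qed
  interpret L: labelled_system M T a N
  proof
    show "a \<in> measurable M (count_space UNIV)"
      unfolding a_def by (rule measurable_Least) measurable
  qed (use MD a in auto)
  obtain m Q where m: "m \<ge> 1" and Q: "Q \<in> words N m \<rightarrow>\<^sub>E \<rat>" "\<And>w. w \<in> words N m \<Longrightarrow> 0 < Q w" "(\<Sum>w\<in>words N m. Q w) \<le> 1"
    and S: "(\<Sum>w\<in>words N m. prob (L.cyl w) * - ln (Q w)) < real m * \<kappa>"
    using L.ex_rational_code[OF ks] by blast
  \<comment> \<open>The cylinder of \<open>w\<close> with \<open>< \<rho>\<close> relaxed to
    \<open>\<le> \<rho>\<close>: closed, and larger only by points whose orbit meets a null sphere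
    before time \<open>m\<close>.\<close>
  define F where "F w = {y \<in> X. \<forall>i<m. dist (c (w ! i)) ((T ^^ i) y) \<le> \<rho> \<and> (\<forall>j<w ! i. \<rho> \<le> dist (c j) ((T ^^ i) y))}" for w
  have block_F: "y \<in> F (L.block m y)" if "y \<in> X" for y
    using a iter_in_X[OF that] that by (auto simp: F_def L.block_def intro: less_imp_le)
  have closed_F: "closed (F w)" for w
  proof -
    have cl: "closed {y \<in> X. f y \<le> g y}" if "continuous_on X f" "continuous_on X g" for f g :: "'a \<Rightarrow> real"
      by (rule continuous_on_closed_Collect_le[OF that closed_X])
    have dc: "continuous_on X (\<lambda>y. dist (c j) ((T ^^ i) y))" for i j
      by (intro continuous_intros continuous_on_iter)
    have "F w = X \<inter> (\<Inter>i<m. {y \<in> X. dist (c (w ! i)) ((T ^^ i) y) \<le> \<rho>} \<inter> (X \<inter> (\<Inter>j<w ! i. {y \<in> X. \<rho> \<le> dist (c j) ((T ^^ i) y)})))"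
      by (auto simp: F_def)
    also have "closed \<dots>"
      by (intro closed_Int closed_INT ballI closed_X cl dc continuous_on_const)
    finally show ?thesis .
  qed
  have F_meas: "measure M (F w) = prob (L.cyl w)" if w: "w \<in> words N m" for w
  proof -
    have wN: "w ! i < N" if "i < m" for i using w that by (auto simp: words_def subset_iff)
    define B where "B = (\<Union>i<m. {y \<in> space M. (T ^^ i) y \<in> {y \<in> space M. dist (c (w ! i)) y = \<rho>}})"
    have B_meas: "B \<in> sets M" unfolding B_def by measurable
    have "prob B \<le> (\<Sum>i<m. prob {y \<in> space M. (T ^^ i) y \<in> {y \<in> space M. dist (c (w ! i)) y = \<rho>}})"
      unfolding B_def by (rule finite_measure_subadditive_finite) auto
    also have "\<dots> = (\<Sum>i<m. prob {y \<in> space M. dist (c (w ! i)) y = \<rho>})"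
      by (intro sum.cong refl L.prob_iter) measurable
    also have "\<dots> = 0" using null wN by simp
    finally have B0: "prob B = 0" using measure_nonneg[of M B] by linarith
    have FM: "F w \<in> sets M"
      unfolding MD(2) sets_restrict_space
    proof (rule image_eqI[where x = "F w"])
      show "F w = X \<inter> F w" by (auto simp: F_def)
    qed (simp add: closed_F)
    have "L.cyl w \<subseteq> F w"
    proof
      fix y assume y: "y \<in> L.cyl w"
      then have "y \<in> X" "L.block m y = w" using w by (auto simp: L.cyl_def words_def MD(5))
      then show "y \<in> F w" using block_F by blast
    qed
    then have "prob (L.cyl w) \<le> prob (F w)" using FM by (rule finite_measure_mono)
    moreover have "F w \<subseteq> L.cyl w \<union> B"
    proof
      fix y assume y: "y \<in> F w"
      show "y \<in> L.cyl w \<union> B"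
      proof (cases "y \<in> B")
        case False
        have yX: "y \<in> X" using y by (simp add: F_def)
        have "a ((T ^^ i) y) = w ! i" if i: "i < m" for i
        proof -
          have "dist (c (w ! i)) ((T ^^ i) y) \<noteq> \<rho>"
            using False i yX iter_in_X[OF yX] by (auto simp: B_def MD(5))
          then have "dist (c (w ! i)) ((T ^^ i) y) < \<rho>" using y i by (auto simp: F_def less_le)
          then show ?thesis
            unfolding a_def using y i by (intro Least_equality) (force simp: F_def not_less[symmetric])+
        qed
        then have "L.block m y = w"
          using w by (intro nth_equalityI) (auto simp: L.block_def words_def)
        then show ?thesis using yX w by (auto simp: L.cyl_def MD(5) words_def)
      qed simp
    qed
    then have "prob (F w) \<le> prob (L.cyl w \<union> B)"
      using B_meas by (intro finite_measure_mono) auto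
    moreover have "\<dots> \<le> prob (L.cyl w) + prob B" using B_meas by (intro measure_Un_le) auto
    ultimately show ?thesis using B0 by linarith
  qed
  define q where "q w = - ln (Q w)" for w
  have q: "0 \<le> q w" if "w \<in> words N m" for w
  proof -
    have "Q w \<le> (\<Sum>w\<in>words N m. Q w)"
      using Q(2) that by (intro member_le_sum) (auto intro: less_imp_le)
    then show ?thesis using Q(2)[OF that] Q(3) by (simp add: q_def)
  qed
  \<comment> \<open>The summand 1 makes \<open>K\<close> positive and leaves slack: errors of
    \<open>gap / K\<close> in all frequencies cost at most
    \<open>gap / K * (K - 1) < gap\<close>.\<close>
  define K where "K = 1 + (\<Sum>w\<in>words N m. q w)"
  define gap where "gap = real m * \<kappa> - (\<Sum>w\<in>words N m. prob (L.cyl w) * q w)"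
  have K: "K > 0" using sum_nonneg[of "words N m" q] q by (simp add: K_def)
  have gap: "gap > 0" using S by (simp add: gap_def q_def)
  have "\<forall>\<^sub>F k in sequentially. \<forall>w\<in>words N m. (\<Sum>j<\<sigma> k. indicator (F w) ((T ^^ j) x)) / real (\<sigma> k) < measure M (F w) + gap / K"
    using closed_F gap K by (intro eventually_ball_finite ballI averages_to_closed[OF MD(1,2) _ _ av]) (auto simp: F_def)
  then obtain k0 where k0: "\<And>k w. k \<ge> k0 \<Longrightarrow> w \<in> words N m \<Longrightarrow>
      (\<Sum>j<\<sigma> k. indicator (F w) ((T ^^ j) x)) / real (\<sigma> k) < measure M (F w) + gap / K"
    unfolding eventually_sequentially by blast
  have low: "x \<in> low_cost_points T X c N eps m Q \<kappa> (\<sigma> k)" if k: "k \<ge> k0" "\<sigma> k > 0" for k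
  proof -
    \<comment> \<open>Labels at all times are used, since the last windows of length
      \<open>m\<close> may run past \<open>\<sigma> k\<close>.\<close>
    define u where "u i = a ((T ^^ i) x)" for i
    have blk: "map (\<lambda>i. u (j + i)) [0..<m] = L.block m ((T ^^ j) x)" for j
    proof -
      have "(T ^^ (j + i)) x = (T ^^ i) ((T ^^ j) x)" for i
        using funpow_add[of i j T] by (simp add: add.commute)
      then show ?thesis by (simp add: L.block_def u_def)
    qed
    \<comment> \<open>The closed sets may overlap, but each orbit point lies in the one of its own
      word, and the surplus terms are nonnegative.\<close>
    have "(\<Sum>j<\<sigma> k. - ln (Q (map (\<lambda>i. u (j + i)) [0..<m])))
        \<le> (\<Sum>j<\<sigma> k. \<Sum>w\<in>words N m. indicator (F w) ((T ^^ j) x) * q w)"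
    proof (rule sum_mono)
      fix j
      define y where "y = (T ^^ j) x"
      have yX: "y \<in> X" using iter_in_X[OF x] by (simp add: y_def)
      have bw: "L.block m y \<in> words N m" using yX by (intro L.block_in_words) (simp add: MD(5))
      have "- ln (Q (map (\<lambda>i. u (j + i)) [0..<m])) = indicator (F (L.block m y)) y * q (L.block m y)"
        using block_F[OF yX] by (simp add: blk q_def y_def)
      also have "\<dots> \<le> (\<Sum>w\<in>words N m. indicator (F w) y * q w)"
        using bw q by (intro member_le_sum[of _ "words N m" "\<lambda>w. indicator (F w) y * q w"]) auto
      finally show "- ln (Q (map (\<lambda>i. u (j + i)) [0..<m])) \<le> (\<Sum>w\<in>words N m. indicator (F w) ((T ^^ j) x) * q w)"
        unfolding y_def .
    qed
    also have "\<dots> = real (\<sigma> k) * (\<Sum>w\<in>words N m. (\<Sum>j<\<sigma> k. indicator (F w) ((T ^^ j) x)) / real (\<sigma> k) * q w)"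
      using k(2) by (subst sum.swap) (simp add: sum_distrib_left flip: sum_distrib_right)
    also have "\<dots> \<le> real (\<sigma> k) * (\<Sum>w\<in>words N m. (prob (L.cyl w) + gap / K) * q w)"
      using k0[OF k(1)] F_meas q by (intro mult_left_mono sum_mono mult_right_mono) (auto intro: less_imp_le)
    also have "(\<Sum>w\<in>words N m. (prob (L.cyl w) + gap / K) * q w) = real m * \<kappa> - gap + gap / K * (K - 1)"
      by (simp add: gap_def K_def distrib_right sum.distrib sum_distrib_left)
    also have "\<dots> = real m * \<kappa> - gap / K" using K by (simp add: field_simps)
    also have "real (\<sigma> k) * (real m * \<kappa> - gap / K) < real (\<sigma> k) * (real m * \<kappa>)"
      using k(2) gap K by (intro mult_strict_left_mono) auto
    finally have "(\<Sum>j<\<sigma> k. - ln (Q (map (\<lambda>i. u (j + i)) [0..<m]))) < real m * (real (\<sigma> k) * \<kappa>)"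
      by (simp add: mult_ac)
    moreover have "u i < N \<and> dist (c (u i)) ((T ^^ i) x) < eps / 2" for i
      using a[OF iter_in_X[OF x], of i] \<rho>(2) by (auto simp: u_def)
    ultimately show ?thesis using x unfolding low_cost_points_def by blast
  qed
  have "\<exists>\<^sub>\<infinity>n. x \<in> low_cost_points T X c N eps m Q \<kappa> n"
    unfolding INFM_nat_le
  proof
    fix n0
    \<comment> \<open>As \<open>\<sigma> k \<ge> k\<close>, the term \<open>Suc n0\<close> secures
      both \<open>\<sigma> k \<ge> n0\<close> and \<open>\<sigma> k > 0\<close>.\<close>
    define k where "k = max k0 (Suc n0)"
    have "k \<le> \<sigma> k" using \<sigma> by (rule strict_mono_imp_increasing)
    then show "\<exists>n\<ge>n0. x \<in> low_cost_points T X c N eps m Q \<kappa> n"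
      by (intro exI[of _ "\<sigma> k"] conjI low) (auto simp: k_def)
  qed
  then show ?thesis using m Q by blast
qed

text \<open>Every point of \<open>Z\<close> is cheap infinitely often for some code. Measures and
  partitions vary with the point, but the centres depend on \<open>eps\<close> alone and the codes
  form a countable set.\<close>

lemma htop_le_limit_entropy:
  assumes Z: "\<And>x. x \<in> Z \<Longrightarrow> x \<in> X \<and> (\<exists>\<sigma>. \<exists>M\<in>Minv X T. strict_mono \<sigma> \<and>
      averages_to X (\<lambda>j. (T ^^ j) x) \<sigma> M \<and> ks_entropy M T \<le> t)"
  shows "htop T X Z \<le> t"
proof (rule htop_le)
  fix eps s :: real assume eps: "eps > 0" and ts: "t < ereal s"
  show "bowen_H T X Z s eps = 0"
  proof (cases "X = {}")
    case True
    then have "Z = (\<Union>i\<in>({}::nat set). {})" using Z by blast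
    then show ?thesis by (metis bowen_H_UN_eq_0 countable_empty empty_iff)
  next
    case False
    \<comment> \<open>Room on both sides: \<open>t < \<kappa>\<close> provides codes of rate below
      \<open>\<kappa>\<close>, and \<open>\<kappa> < s\<close> makes the covering sums
      converge.\<close>
    obtain \<kappa> where \<kappa>: "t < ereal \<kappa>" "\<kappa> < s"
      using ereal_dense2[OF ts] by auto
    have "X \<subseteq> (\<Union>c\<in>X. ball c (eps / 4))" using eps by force
    then obtain F where F: "F \<subseteq> X" "finite F" "X \<subseteq> (\<Union>c\<in>F. ball c (eps / 4))"
      using compactE_image[OF compact_X, of X "\<lambda>c. ball c (eps / 4)"] by auto
    obtain c :: "nat \<Rightarrow> 'a" and N where c: "F = c ` {..<N}"
      using F(2) by (metis finite_imp_nat_seg_image_inj_on lessThan_def)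
    have cover: "X \<subseteq> (\<Union>j<N. ball (c j) (eps / 4))" using F(3) unfolding c by simp
    have N: "N \<ge> 1" using cover False by (cases N) auto
    define I where "I = (SIGMA m:{1..}. {Q \<in> words N m \<rightarrow>\<^sub>E (\<rat>::real set). (\<forall>w\<in>words N m. 0 < Q w) \<and> (\<Sum>w\<in>words N m. Q w) \<le> 1})"
    define G where "G = (\<lambda>(m, Q). {x. \<exists>\<^sub>\<infinity>n. x \<in> low_cost_points T X c N eps m Q \<kappa> n})"
    have "countable I"
      unfolding I_def
    proof (rule countable_SIGMA)
      fix m
      have "countable (words N m \<rightarrow>\<^sub>E (\<rat>::real set))" by (intro countable_PiE countable_rat) simp
      then show "countable {Q \<in> words N m \<rightarrow>\<^sub>E (\<rat>::real set). (\<forall>w\<in>words N m. 0 < Q w) \<and> (\<Sum>w\<in>words N m. Q w) \<le> 1}"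
        by (rule countable_subset[rotated]) auto
    qed simp
    moreover have "bowen_H T X (G i) s eps = 0" if "i \<in> I" for i
      using that N \<kappa>(2) unfolding I_def G_def by (auto intro!: bowen_H_limsup_low_cost)
    ultimately have *: "bowen_H T X (\<Union>i\<in>I. G i) s eps = 0" by (rule bowen_H_UN_eq_0)
    have "Z \<subseteq> (\<Union>i\<in>I. G i)"
    proof
      fix x assume "x \<in> Z"
      then obtain \<sigma> M where x: "x \<in> X" and M: "M \<in> Minv X T" "strict_mono \<sigma>" "averages_to X (\<lambda>j. (T ^^ j) x) \<sigma> M" "ks_entropy M T \<le> t"
        using Z by blast
      have "ks_entropy M T < ereal \<kappa>" using M(4) \<kappa>(1) by (rule le_less_trans)
      from frequently_low_cost[OF M(1) x M(2,3) this eps cover]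
      obtain m Q where "(m, Q) \<in> I" "\<exists>\<^sub>\<infinity>n. x \<in> low_cost_points T X c N eps m Q \<kappa> n"
        unfolding I_def by blast
      then show "x \<in> (\<Union>i\<in>I. G i)" unfolding G_def by blast
    qed
    then have "bowen_H T X Z s eps \<le> bowen_H T X (\<Union>i\<in>I. G i) s eps" by (intro bowen_H_mono) auto
    then show ?thesis using * by simp
  qed
qed

lemma generic_points_eq: "generic_points X T M = {x \<in> X. averages_to X (\<lambda>j. (T ^^ j) x) (\<lambda>n. n) M}"
  by (simp add: generic_points_def averages_to_def)

text \<open>\<open>V_Phi\<close> averages over the times \<open>1..n\<close>,
  \<open>averages_to\<close> over \<open>0..n-1\<close>; invariance of \<open>M\<close> absorbs the
  shift.\<close>

lemma V_Phi_tendsto: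
  fixes \<Phi> :: "(nat \<Rightarrow> 'a) \<Rightarrow> ('b::real_normed_vector \<Rightarrow>\<^sub>L real)"
  assumes \<Phi>: "continuous_map (product_topology (\<lambda>_. top_of_set X) {..<r}) euclideanreal (\<lambda>z. blinfun_apply (\<Phi> z) w)"
    and M: "M \<in> Minv X T" and x: "x \<in> X" and av: "averages_to X (\<lambda>j. (T ^^ j) x) \<sigma> M"
  shows "(\<lambda>k. blinfun_apply (V_Phi T \<Phi> r (\<sigma> k) x) w) \<longlonglongrightarrow> (\<integral>z. blinfun_apply (\<Phi> z) w \<partial>PiM {..<r} (\<lambda>_. M))"
proof -
  note MD = Minv_D[OF M]
  have shift: "(\<lambda>k. (\<Sum>i=1..\<sigma> k. f ((T ^^ i) x)) / real (\<sigma> k)) \<longlonglongrightarrow> integral\<^sup>L M f" if f: "continuous_on X f" for f :: "'a \<Rightarrow> real"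
  proof -
    have "continuous_on X (\<lambda>y. f (T y))" using continuous_on_compose2[OF f continuous_T T_X] .
    then have "(\<lambda>k. (\<Sum>j<\<sigma> k. f (T ((T ^^ j) x))) / real (\<sigma> k)) \<longlonglongrightarrow> (\<integral>y. f (T y) \<partial>M)"
      using av unfolding averages_to_def by blast
    moreover have "(\<integral>y. f (T y) \<partial>M) = integral\<^sup>L M f"
      using integral_distr[OF MD(3) borel_measurable_continuous_on_carrier[OF MD(2) f]] MD(4) by simp
    ultimately show ?thesis by (simp add: sum.atLeast1_atMost_eq)
  qed
  from product_averages[OF compact_X MD(1,2) iter_in_X[OF x] shift \<Phi>]
  show ?thesis by (simp add: V_Phi_def blinfun.scaleR_left blinfun.sum_left)
qed

end

theorem theorem4p1:
  fixes X :: "'a::metric_space set" and T :: "'a \<Rightarrow> 'a" and r :: nat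
    and \<Phi> :: "(nat \<Rightarrow> 'a) \<Rightarrow> ('b::banach \<Rightarrow>\<^sub>L real)"
    and \<alpha> :: "'b \<Rightarrow>\<^sub>L real" and W :: "'b set"
  assumes "compact X" and "continuous_on X T" and "T ` X \<subseteq> X"
    and "saturated X T"
    and "r \<ge> 1"
    and "\<forall>w. continuous_map (product_topology (\<lambda>_. top_of_set X) {..<r}) euclideanreal
               (\<lambda>z. blinfun_apply (\<Phi> z) w)"
  shows "(M_Phi X T \<Phi> r \<alpha> W = {} \<longrightarrow> E_Phi X T \<Phi> r \<alpha> W = {}) \<and>
         (M_Phi X T \<Phi> r \<alpha> W \<noteq> {} \<longrightarrow>
            htop T X (E_Phi X T \<Phi> r \<alpha> W) = (SUP \<mu> \<in> M_Phi X T \<Phi> r \<alpha> W. ks_entropy \<mu> T))"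
proof -
  interpret compact_system X T using assms(1-3) by unfold_locales
  let ?E = "E_Phi X T \<Phi> r \<alpha> W" and ?M = "M_Phi X T \<Phi> r \<alpha> W"
  note conv = V_Phi_tendsto[OF assms(6)[rule_format]]
  \<comment> \<open>This serves twice: it turns a point of \<open>?E\<close> into an element of
    \<open>?M\<close>, which settles emptiness, and it supplies the limit measures for the upper
    bound.\<close>
  have limit: "\<exists>\<sigma>. \<exists>M\<in>?M. strict_mono \<sigma> \<and> averages_to X (\<lambda>j. (T ^^ j) x) \<sigma> M" if x: "x \<in> ?E" for x
  proof -
    have xX: "x \<in> X" using x by (simp add: E_Phi_def)
    obtain \<sigma> M where M: "M \<in> Minv X T" "strict_mono \<sigma>" "averages_to X (\<lambda>j. (T ^^ j) x) \<sigma> M"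
      using ex_limit_measure[OF xX] by blast
    have "(\<integral>z. blinfun_apply (\<Phi> z) w \<partial>PiM {..<r} (\<lambda>_. M)) \<le> blinfun_apply \<alpha> w" if w: "w \<in> W" for w
    proof -
      let ?v = "\<lambda>n. ereal (blinfun_apply (V_Phi T \<Phi> r n x) w)"
      have "(?v \<circ> \<sigma>) \<longlonglongrightarrow> ereal (\<integral>z. blinfun_apply (\<Phi> z) w \<partial>PiM {..<r} (\<lambda>_. M))"
        using conv[OF M(1) xX M(3)] by (simp add: o_def)
      then have "ereal (\<integral>z. blinfun_apply (\<Phi> z) w \<partial>PiM {..<r} (\<lambda>_. M)) = limsup (?v \<circ> \<sigma>)"
        by (simp add: lim_imp_Limsup)
      \<comment> \<open>Passing to a subsequence can only lower the \<open>limsup\<close>, which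
        matches the upper bound in \<open>E_Phi\<close>.\<close>
      also have "\<dots> \<le> limsup ?v" using M(2) by (rule limsup_subseq_mono)
      also have "\<dots> \<le> ereal (blinfun_apply \<alpha> w)" using x w by (simp add: E_Phi_def)
      finally show ?thesis by simp
    qed
    then have "M \<in> ?M" using M(1) by (simp add: M_Phi_def)
    then show ?thesis using M by blast
  qed
  have generic: "generic_points X T M \<subseteq> ?E" if M: "M \<in> ?M" for M
  proof
    fix x assume "x \<in> generic_points X T M"
    then have x: "x \<in> X" "averages_to X (\<lambda>j. (T ^^ j) x) (\<lambda>n. n) M" by (simp_all add: generic_points_eq)
    have "limsup (\<lambda>n. ereal (blinfun_apply (V_Phi T \<Phi> r n x) w)) \<le> ereal (blinfun_apply \<alpha> w)" if w: "w \<in> W" for w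
    proof -
      have "(\<lambda>n. ereal (blinfun_apply (V_Phi T \<Phi> r n x) w)) \<longlonglongrightarrow> ereal (\<integral>z. blinfun_apply (\<Phi> z) w \<partial>PiM {..<r} (\<lambda>_. M))"
        using conv[OF _ x] M by (simp add: M_Phi_def)
      then have "limsup (\<lambda>n. ereal (blinfun_apply (V_Phi T \<Phi> r n x) w)) = ereal (\<integral>z. blinfun_apply (\<Phi> z) w \<partial>PiM {..<r} (\<lambda>_. M))"
        by (simp add: lim_imp_Limsup)
      then show ?thesis using M w by (simp add: M_Phi_def)
    qed
    then show "x \<in> ?E" using x(1) by (simp add: E_Phi_def)
  qed
  have "htop T X ?E \<le> (SUP \<mu>\<in>?M. ks_entropy \<mu> T)"
  proof (rule htop_le_limit_entropy)
    fix x assume x: "x \<in> ?E"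
    obtain \<sigma> M where M: "M \<in> ?M" "strict_mono \<sigma>" "averages_to X (\<lambda>j. (T ^^ j) x) \<sigma> M"
      using limit[OF x] by blast
    moreover have "ks_entropy M T \<le> (SUP \<mu>\<in>?M. ks_entropy \<mu> T)" using M(1) by (rule SUP_upper)
    moreover have "M \<in> Minv X T" using M(1) by (simp add: M_Phi_def)
    ultimately show "x \<in> X \<and> (\<exists>\<sigma>. \<exists>M\<in>Minv X T. strict_mono \<sigma> \<and>
      averages_to X (\<lambda>j. (T ^^ j) x) \<sigma> M \<and> ks_entropy M T \<le> (SUP \<mu>\<in>?M. ks_entropy \<mu> T))"
      using x by (auto simp: E_Phi_def)
  qed
  moreover have "(SUP \<mu>\<in>?M. ks_entropy \<mu> T) \<le> htop T X ?E"
  proof (rule SUP_least)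
    fix M assume M: "M \<in> ?M"
    then have "ks_entropy M T = htop T X (generic_points X T M)"
      using assms(4) by (simp add: saturated_def M_Phi_def)
    also have "\<dots> \<le> htop T X ?E" using generic[OF M] by (rule htop_mono)
    finally show "ks_entropy M T \<le> htop T X ?E" .
  qed
  ultimately show ?thesis using limit by (auto intro: antisym)
qed

end
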